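(* Let $m\ge2$ be an integer and $\delta>-m$. Let $(\xi_t)_{t\ge0}$ be the embedding birth process defined by the sequence $(k+1+\delta/m)_{k\in\mathbb{N}}$, and let $(\mathrm{CBP}^{(m)}_t)_{t\ge0}$ be the corresponding collapsed branching process. Consider the discrete-time preferential attachment model defined by $\mathrm{PA}_{n,j}(m,\delta)=\mathrm{CBP}^{(m)}_{\tau_{(n,j)}}$ for $n\ge1$ and $j\in\{1,\ldots,m\}$. Then, for every $k\in\mathbb{N}$ (and every $j\in\{1,\dots,m\}$), as $n\to\infty$, the fraction of vertices with (in-)degree $k$ in $\mathrm{PA}_{n,j}(m,\delta)$ converges in probability to $$p_k^{(m)}=\left(2+\delta/m\right)\frac{\Gamma(2+\delta/m+m+\delta)}{\Gamma(m+\delta)}\,\frac{\Gamma(k+m+\delta)}{\Gamma(k+m+\delta+3+\delta/m)}.$$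
   Context: Degrees $k$ range over $\mathbb{N}=\{0,1,2,\dots\}$; individuals and vertices are numbered from $1$. Embedding birth process defined by positive numbers $(\lambda_k)_{k\in\mathbb{N}}$: let $(E_k)_{k\in\mathbb{N}}$ be independent, $E_k$ exponential with parameter $\lambda_k$, $E_{-1}=0$; then $\xi_t=k$ if $t\in[E_{-1}+\cdots+E_{k-1},\,E_{-1}+\cdots+E_k)$; set $\xi_t=0$ for $t<0$. Continuous-time branching process defined by $\xi$: it starts with one individual born at time $0$; each individual $x$, born at time $\tau_x$, carries an i.i.d. copy $\xi^x$ of $\xi$ and gives birth to a child at time $\tau_x+s$ for each jump time $s$ of $\xi^x$; individuals never die. Individuals are labelled $1,2,\ldots$ in order of birth, with birth times $\tau_1\le\tau_2\le\cdots$. The associated tree has a directed edge from each individual other than the first to its parent. Collapsed branching process: write $(n,j)=m(n-1)+j$ for $n\ge1$, $j=1,\ldots,m$. $\mathrm{CBP}^{(m)}_t$ is the directed multigraph whose vertex $n$ is obtained by merging individuals $(n,1),\ldots,(n,m)$; vertex $n$ is present at time $t$ when $\tau_{(n,1)}\le t$; the number of directed edges from vertex $x$ to vertex $y$ is the number of $j\in\{1,\dots,m\}$ such that $\tau_{(x,j)}\le t$ and the parent of individual $(x,j)$ is one of $(y,1),\ldots,(y,m)$. The (in-)degree of vertex $n$ at time $t$ is $D^{(\mathrm{in})}_n(t)=\sum_{j=1}^m\xi^{(n,j)}_{t-\tau_{(n,j)}}$. In particular $\mathrm{PA}_{n,j}(m,\delta)$ has $n$ vertices. *)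

theory Defs
  imports "HOL-Probability.Probability" "Graph_Theory.Digraph"
begin

section \<open>Embedding birth process\<close>

text \<open>
  One realisation of the process is given by its sequence of holding times \<open>s\<close>: the state \<open>k\<close> is
  occupied during \<open>[s 0 + ... + s (k - 1), s 0 + ... + s k)\<close>.  Outside the null event that some
  holding time is not positive, at most one \<open>k\<close> qualifies, and the \<open>LEAST\<close> makes no choice.
\<close>

definition birth_count :: "(nat \<Rightarrow> real) \<Rightarrow> real \<Rightarrow> nat" where
  "birth_count s t = (if t < 0 then 0 else (LEAST k. t \<in> {(\<Sum>i<k. s i) ..< (\<Sum>i\<le>k. s i)}))"

text \<open>The time of the jump from \<open>k\<close> to \<open>k + 1\<close>.\<close>

definition jump_time :: "(nat \<Rightarrow> real) \<Rightarrow> nat \<Rightarrow> real" where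
  "jump_time s k = (\<Sum>i\<le>k. s i)"

section \<open>Continuous-time branching process\<close>

text \<open>
  Individuals are first named by their ancestry: \<open>[]\<close> is the initial individual and \<open>k # x\<close> is the
  child that \<open>x\<close> has at the \<open>k\<close>-th jump (counting from \<open>0\<close>) of its own birth process.  A realisation
  of the branching process is a family \<open>e\<close>, where \<open>e x\<close> is the sequence of holding times of \<open>x\<close>.
  In \<open>birth_clocks M r E\<close> the copies carried by the individuals are i.i.d. embedding birth processes
  defined by the sequence \<open>r\<close>.
\<close>

definition birth_clocks ::
  "'w measure \<Rightarrow> (nat \<Rightarrow> real) \<Rightarrow> (nat list \<Rightarrow> nat \<Rightarrow> 'w \<Rightarrow> real) \<Rightarrow> bool" where
  "birth_clocks M r E \<longleftrightarrow>
     prob_space M \<and>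
     prob_space.indep_vars M (\<lambda>_. borel) (\<lambda>(x, k). E x k) UNIV \<and>
     (\<forall>x k. distributed M lborel (E x k) (exponential_density (r k)))"

primrec birth_time :: "(nat list \<Rightarrow> nat \<Rightarrow> real) \<Rightarrow> nat list \<Rightarrow> real" where
  "birth_time e [] = 0"
| "birth_time e (k # x) = birth_time e x + jump_time (e x) k"

text \<open>
  Order of birth.  Simultaneous births form a null event; \<open>to_nat\<close> only serves to make the order
  total there.
\<close>

definition born_before :: "(nat list \<Rightarrow> nat \<Rightarrow> real) \<Rightarrow> nat list \<Rightarrow> nat list \<Rightarrow> bool" where
  "born_before e y x \<longleftrightarrow>
     birth_time e y < birth_time e x \<or>
     birth_time e y = birth_time e x \<and> to_nat y < to_nat x"

text \<open>The \<open>n\<close>-th individual in order of birth; the numbering starts with \<open>n = 1\<close>.\<close>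

definition individual :: "(nat list \<Rightarrow> nat \<Rightarrow> real) \<Rightarrow> nat \<Rightarrow> nat list" where
  "individual e n = (THE x. finite {y. born_before e y x} \<and> Suc (card {y. born_before e y x}) = n)"

definition tau :: "(nat list \<Rightarrow> nat \<Rightarrow> real) \<Rightarrow> nat \<Rightarrow> real" where
  "tau e n = birth_time e (individual e n)"

definition is_parent :: "(nat list \<Rightarrow> nat \<Rightarrow> real) \<Rightarrow> nat \<Rightarrow> nat \<Rightarrow> bool" where
  "is_parent e p c \<longleftrightarrow> (\<exists>k. individual e c = k # individual e p)"

section \<open>Collapsed branching process\<close>

definition idx :: "nat \<Rightarrow> nat \<Rightarrow> nat \<Rightarrow> nat" where
  "idx m n j = m * (n - 1) + j"

text \<open>
  The arc \<open>(x, j)\<close> is the edge from individual \<open>(x, j)\<close> to its parent; it starts in vertex \<open>x\<close> and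
  ends in the vertex into which the parent is merged.
\<close>

definition cbp ::
  "(nat list \<Rightarrow> nat \<Rightarrow> real) \<Rightarrow> nat \<Rightarrow> real \<Rightarrow> (nat, nat \<times> nat) pre_digraph" where
  "cbp e m t =
     \<lparr> verts = {n. 1 \<le> n \<and> tau e (idx m n 1) \<le> t},
       arcs = {(x, j). 1 \<le> x \<and> j \<in> {1..m} \<and> tau e (idx m x j) \<le> t \<and>
                 (\<exists>y\<ge>1. \<exists>i\<in>{1..m}. is_parent e (idx m y i) (idx m x j))},
       tail = fst,
       head = (\<lambda>(x, j). THE y. 1 \<le> y \<and> (\<exists>i\<in>{1..m}. is_parent e (idx m y i) (idx m x j))) \<rparr>"

definition cbp_degree :: "(nat list \<Rightarrow> nat \<Rightarrow> real) \<Rightarrow> nat \<Rightarrow> nat \<Rightarrow> real \<Rightarrow> nat" where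
  "cbp_degree e m n t =
     (\<Sum>j=1..m. birth_count (e (individual e (idx m n j))) (t - tau e (idx m n j)))"

lemma birth_count_eq_card:
  assumes pos: "\<And>k. 0 < s k" and fin: "finite {k. jump_time s k \<le> t}"
  shows "birth_count s t = card {k. jump_time s k \<le> t}"
proof -
  have mono: "jump_time s k < jump_time s l" if "k < l" for k l
  proof -
    have "strict_mono (jump_time s)"
      by (rule strict_monoI_Suc) (simp add: jump_time_def pos)
    then show ?thesis using that by (simp add: strict_mono_less)
  qed
  show ?thesis
  proof (cases "t < 0")
    case True
    have "0 < jump_time s k" for k
      unfolding jump_time_def by (intro sum_pos) (auto simp: pos)
    then have "{k. jump_time s k \<le> t} = {}" using True
      by (auto simp: not_le intro: less_trans)
    then show ?thesis using True by (simp add: birth_count_def)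
  next
    case False
    define n where "n = (LEAST k. t < jump_time s k)"
    have "\<exists>k. t < jump_time s k"
      using fin infinite_UNIV_nat by (metis (mono_tags, lifting) UNIV_eq_I mem_Collect_eq not_less)
    then have n: "t < jump_time s n" unfolding n_def by (rule LeastI_ex)
    have less: "jump_time s k \<le> t" if "k < n" for k
      using not_less_Least[OF that[unfolded n_def]] by simp
    have set: "{k. jump_time s k \<le> t} = {..<n}"
    proof (intro set_eqI iffI)
      fix k assume "k \<in> {k. jump_time s k \<le> t}"
      then have "\<not> n < k \<and> n \<noteq> k" using n mono[of n k] by auto
      then show "k \<in> {..<n}" by simp
    qed (use less in auto)
    have low: "(\<Sum>i<n. s i) \<le> t"
    proof (cases n)
      case (Suc l)
      then show ?thesis using less[of l] by (simp add: jump_time_def lessThan_Suc_atMost)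
    qed (use False in auto)
    have "(LEAST k. t \<in> {(\<Sum>i<k. s i) ..< (\<Sum>i\<le>k. s i)}) = n"
    proof (rule Least_equality)
      show "t \<in> {(\<Sum>i<n. s i) ..< (\<Sum>i\<le>n. s i)}" using low n by (simp add: jump_time_def)
      fix k assume "t \<in> {(\<Sum>i<k. s i) ..< (\<Sum>i\<le>k. s i)}"
      then have "t < jump_time s k" by (simp add: jump_time_def)
      then show "n \<le> k" using less[of k] by (cases "k < n") auto
    qed
    then show ?thesis using False by (simp add: birth_count_def set)
  qed
qed

lemma individual_bij:
  assumes fin: "\<And>t. finite {x. birth_time e x \<le> t}"
  shows "bij_betw (individual e) {1..} UNIV"
proof -
  define R where "R x = Suc (card {y. born_before e y x})" for x
  have finb: "finite {y. born_before e y x}" for x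
    by (rule finite_subset[OF _ fin[of "birth_time e x"]]) (auto simp: born_before_def)
  have R_less: "R x < R y" if "born_before e x y" for x y
  proof -
    have "{z. born_before e z x} \<subset> {z. born_before e z y}"
      using that by (auto simp: born_before_def psubset_eq)
    then show ?thesis unfolding R_def by (simp add: psubset_card_mono finb)
  qed
  have total: "x = y \<or> born_before e x y \<or> born_before e y x" for x y
    unfolding born_before_def by (metis linorder_neqE_linordered_idom linorder_neqE_nat to_nat_split)
  have R_iff: "R x < R y \<longleftrightarrow> born_before e x y" for x y
    using total[of x y] R_less[of x y] R_less[of y x] by auto
  have injR: "inj R" by (rule injI) (metis R_less total less_irrefl)
  have surjR: "\<exists>x. R x = n" if n: "1 \<le> n" for n
  proof -
    have f: "finite {x. R x < n}"
      using finite_vimageI[OF finite_lessThan[of n] injR] by (simp add: vimage_def)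
    then have "\<exists>x. n \<le> R x"
      using infinite_UNIV_listI by (metis (mono_tags, lifting) UNIV_eq_I mem_Collect_eq not_less)
    then obtain x where x: "n \<le> R x" and min: "\<And>y. n \<le> R y \<Longrightarrow> R x \<le> R y"
      using exists_least_iff[of "\<lambda>r. \<exists>x. r = R x \<and> n \<le> R x"] by (metis not_less)
    have "{y. born_before e y x} = {y. R y < n}"
      using x min by (auto simp: R_iff[symmetric] not_less) (meson not_less)
    moreover have "card {y. R y < n} \<le> card {1..<n}"
    proof (rule card_inj_on_le[where f = R])
      show "inj_on R {y. R y < n}" using injR by (rule inj_on_subset) auto
      show "R ` {y. R y < n} \<subseteq> {1..<n}" by (auto simp: R_def)
    qed simp
    ultimately have "R x \<le> n" using n by (simp add: R_def)
    then show ?thesis using x by auto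
  qed
  have ind: "individual e (R x) = x" for x
    unfolding individual_def
  proof (rule the_equality)
    fix y assume "finite {z. born_before e z y} \<and> Suc (card {z. born_before e z y}) = R x"
    then have "R y = R x" by (simp add: R_def)
    then show "y = x" using injR by (simp add: inj_eq)
  qed (simp add: finb R_def)
  show ?thesis
  proof (rule bij_betw_byWitness[where f' = R])
    show "\<forall>n\<in>{1..}. R (individual e n) = n" using surjR ind by (metis atLeast_iff)
  qed (auto simp: ind, simp add: R_def)
qed

lemma idx_bij: 
  assumes "1 \<le> m"
  shows "bij_betw (\<lambda>(n, j). idx m n j) ({1..} \<times> {1..m}) {1..}"
proof (rule bij_betw_byWitness[where f' = "\<lambda>i. ((i - 1) div m + 1, (i - 1) mod m + 1)"])
  have "(m * (n - 1) + j - 1) div m = n - 1 \<and> (m * (n - 1) + j - 1) mod m = j - 1"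
    if "1 \<le> j" "j \<le> m" for n j
  proof -
    have "m * (n - 1) + j - 1 = m * (n - 1) + (j - 1)" using that by simp
    moreover have "j - 1 < m" using that by simp
    ultimately show ?thesis by (metis add.right_neutral add_diff_cancel_left' add_0 div_less
      div_mult_self4 gr_implies_not0 mod_less mod_mult_self4 mult.commute add.commute)
  qed
  then show "\<forall>a\<in>{1..} \<times> {1..m}. (((case a of (n, j) \<Rightarrow> idx m n j) - 1) div m + 1,
     ((case a of (n, j) \<Rightarrow> idx m n j) - 1) mod m + 1) = a"
    by (auto simp: idx_def)
  show "(\<lambda>i. ((i - 1) div m + 1, (i - 1) mod m + 1)) ` {1..} \<subseteq> {1..} \<times> {1..m}"
    using assms by (auto simp: Suc_le_eq)
qed (use assms in \<open>auto simp: idx_def\<close>)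

text \<open>
  For a realisation with positive holding times and finitely many births up to any time (which, for
  rates growing linearly, is almost every realisation), \<open>individual\<close> enumerates all individuals
  and \<open>cbp_degree\<close> is the in-degree in the multigraph.
\<close>

lemma in_degree_cbp:
  assumes m: "1 \<le> m" and v: "1 \<le> v"
    and pos: "\<And>x k. 0 < e x k" and fin: "\<And>t. finite {x. birth_time e x \<le> t}"
  shows "in_degree (cbp e m t) v = cbp_degree e m v t"
proof -
  define F where "F = (\<lambda>(n, j). individual e (idx m n j))"
  define V where "V = {1::nat..} \<times> {1..m}"
  have bij: "bij_betw F V UNIV"
    using bij_betw_trans[OF idx_bij[OF m] individual_bij[of e, OF fin]]
    by (simp add: F_def V_def comp_def case_prod_unfold)
  have inj: "F a = F b \<longleftrightarrow> a = b" if "a \<in> V" "b \<in> V" for a b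
    using bij that by (meson bij_betw_imp_inj_on inj_onD)
  have uniq: "y = y'" if "1 \<le> y" "i \<in> {1..m}" "is_parent e (idx m y i) c"
      "1 \<le> y'" "i' \<in> {1..m}" "is_parent e (idx m y' i') c" for y i y' i' c
    using that inj[of "(y, i)" "(y', i')"] by (auto simp: is_parent_def F_def V_def)
  have head: "head (cbp e m t) (x, j) = y"
    if "1 \<le> y" "i \<in> {1..m}" "is_parent e (idx m y i) (idx m x j)" for x j y i
  proof -
    have "(THE y. 1 \<le> y \<and> (\<exists>i\<in>{1..m}. is_parent e (idx m y i) (idx m x j))) = y"
      using that uniq by (intro the_equality) blast+
    then show ?thesis by (simp add: cbp_def)
  qed
  have arcs: "in_arcs (cbp e m t) v =
      {a \<in> V. birth_time e (F a) \<le> t \<and> (\<exists>i\<in>{1..m}. \<exists>k. F a = k # F (v, i))}" (is "_ = ?A")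
  proof (intro set_eqI iffI)
    fix a assume a: "a \<in> in_arcs (cbp e m t) v"
    obtain x j where xj: "a = (x, j)" by (cases a)
    from a obtain y i where y: "1 \<le> y" "i \<in> {1..m}" "is_parent e (idx m y i) (idx m x j)"
      by (auto simp: xj cbp_def)
    have "y = v" using a head[OF y] by (simp add: xj)
    then show "a \<in> ?A" using a y
      by (auto simp: xj cbp_def V_def F_def tau_def is_parent_def)
  next
    fix a assume a: "a \<in> ?A"
    obtain x j where xj: "a = (x, j)" by (cases a)
    from a obtain i where i: "i \<in> {1..m}" "is_parent e (idx m v i) (idx m x j)"
      by (auto simp: xj F_def is_parent_def)
    have "\<exists>y\<ge>1. \<exists>i\<in>{1..m}. is_parent e (idx m y i) (idx m x j)" using v i by blast
    then have "a \<in> arcs (cbp e m t)"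
      using a unfolding xj cbp_def by (simp add: V_def F_def tau_def)
    then show "a \<in> in_arcs (cbp e m t) v" using head[OF v i] by (simp add: xj)
  qed
  define K where "K i = {k. birth_time e (k # F (v, i)) \<le> t}" for i
  have K: "K i = {k. jump_time (e (F (v, i))) k \<le> t - tau e (idx m v i)}" for i
    by (auto simp: K_def tau_def F_def)
  have finK: "finite (K i)" for i
  proof -
    have "inj (\<lambda>k. k # F (v, i))" by (auto intro: injI)
    from finite_vimageI[OF fin[of t] this] show ?thesis by (simp add: K_def vimage_def)
  qed
  have "F ` ?A = (\<lambda>(i, k). k # F (v, i)) ` Sigma {1..m} K"
  proof (intro set_eqI iffI)
    fix x assume "x \<in> (\<lambda>(i, k). k # F (v, i)) ` Sigma {1..m} K"
    then obtain i k where ik: "i \<in> {1..m}" "k \<in> K i" "x = k # F (v, i)" by auto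
    obtain a where a: "a \<in> V" "F a = x"
      using bij by (metis UNIV_I bij_betw_imp_surj_on imageE)
    then have "a \<in> ?A" using ik by (auto simp: K_def simp del: birth_time.simps)
    then show "x \<in> F ` ?A" using a by blast
  next
    fix x assume "x \<in> F ` ?A"
    then obtain i k where ik: "birth_time e x \<le> t" "i \<in> {1..m}" "x = k # F (v, i)" by auto
    then have "(i, k) \<in> Sigma {1..m} K" by (simp add: K_def)
    then show "x \<in> (\<lambda>(i, k). k # F (v, i)) ` Sigma {1..m} K" using ik(3) by (auto intro: rev_image_eqI)
  qed
  moreover have "inj_on F ?A"
    using bij by (auto simp: bij_betw_def intro: inj_on_subset)
  moreover have "inj_on (\<lambda>(i, k). k # F (v, i)) (Sigma {1..m} K)"
    using v by (auto simp: inj_on_def inj V_def)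
  ultimately have "card ?A = card (Sigma {1..m} K)"
    by (metis (no_types, lifting) card_image)
  also have "\<dots> = (\<Sum>i=1..m. card (K i))" using finK by simp
  also have "\<dots> = cbp_degree e m v t"
    unfolding cbp_degree_def
  proof (rule sum.cong)
    fix i
    show "card (K i) =
        birth_count (e (individual e (idx m v i))) (t - tau e (idx m v i))"
      using birth_count_eq_card[of "e (F (v, i))" "t - tau e (idx m v i)"] finK[of i] pos
      by (simp add: K F_def)
  qed simp
  finally show ?thesis by (simp add: in_degree_def arcs)
qed

section \<open>Preferential attachment model\<close>

definition pa :: "(nat list \<Rightarrow> nat \<Rightarrow> real) \<Rightarrow> nat \<Rightarrow> nat \<Rightarrow> nat \<Rightarrow> (nat, nat \<times> nat) pre_digraph" where
  "pa e m n j = cbp e m (tau e (idx m n j))"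

definition pa_degree :: "(nat list \<Rightarrow> nat \<Rightarrow> real) \<Rightarrow> nat \<Rightarrow> nat \<Rightarrow> nat \<Rightarrow> nat \<Rightarrow> nat" where
  "pa_degree e m n j v = cbp_degree e m v (tau e (idx m n j))"

definition degree_fraction ::
  "(nat list \<Rightarrow> nat \<Rightarrow> real) \<Rightarrow> nat \<Rightarrow> nat \<Rightarrow> nat \<Rightarrow> nat \<Rightarrow> real" where
  "degree_fraction e m n j k =
     real (card {v \<in> verts (pa e m n j). pa_degree e m n j v = k}) / real (card (verts (pa e m n j)))"

section \<open>Convergence in probability\<close>

definition converges_in_probability ::
  "'w measure \<Rightarrow> (nat \<Rightarrow> 'w \<Rightarrow> real) \<Rightarrow> ('w \<Rightarrow> real) \<Rightarrow> bool" where
  "converges_in_probability M X Y \<longleftrightarrow>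
     (\<forall>n. X n \<in> borel_measurable M) \<and> Y \<in> borel_measurable M \<and>
     (\<forall>\<epsilon>>0. (\<lambda>n. measure M {\<omega> \<in> space M. \<bar>X n \<omega> - Y \<omega>\<bar> > \<epsilon>}) \<longlonglongrightarrow> 0)"

end

theory Submission
  imports Defs
begin

text \<open>
  By the memoryless property, the branching process seen at its birth times is a discrete Markov
  chain: given the parents of the first individuals, the next individual is born to an individual
  with \<open>d\<close> children with probability proportional to \<open>d + c\<close>, where \<open>c = 1 + \<delta> / m\<close>.  In this
  chain the count of the vertices of degree \<open>k\<close> has a drift towards a multiple of the number of
  vertices, plus a term that is linear in the deviation of the count for \<open>k - 1\<close>.  By induction on
  \<open>k\<close> the second moment of the deviation grows at most linearly in time, so the fractions converge
  in probability by Chebyshev's inequality.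
\<close>

section \<open>Racing exponential clocks\<close>

text \<open>No conditional expectations occur. There are finitely many histories of each length, and
  each is an explicit event on which the clocks that have not yet rung have product-form tails; a
  single race carries this property from a history to its extensions. All moments are then finite
  sums over histories.

  The total rate after \<open>L\<close> births is \<open>L + (L + 1) * c\<close> whatever the
  history, since every birth adds one child to somebody. This keeps the drifts linear in the counts.
  A vertex of degree \<open>k\<close> collects the rate \<open>k + m * c\<close> from its
  \<open>m\<close> individuals, and in equilibrium its count must grow by \<open>q k / m\<close> per
  birth. Clearing the total rate, about \<open>(1 + c) * L\<close>, gives
  \<open>(k - 1 + m * c) * q (k - 1) = (1 + c + k + m * c) * q k\<close>, which the Gamma quotient
  solves.

  Two things spoil exact linearity: the last vertex may have fewer than \<open>m\<close>
  individuals, and new vertices come only every \<open>m\<close> births. Both cost a bounded error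
  in the drift, which is harmless because second moments of order \<open>L\<close> are compared with
  the square of \<open>n\<close>.\<close>

lemma exponential_tail:
  assumes "0 < l"
  shows "emeasure (density lborel (exponential_density l)) {t<..} = ennreal (exp (- l * max 0 t))"
proof -
  define D where "D = density lborel (\<lambda>x. ennreal (exponential_density l x))"
  interpret D: prob_space D
    unfolding D_def using assms by (rule prob_space_exponential_density)
  have [simp]: "space D = UNIV" "sets D = sets borel" by (simp_all add: D_def)
  have "distributed D lborel (\<lambda>x. x) (exponential_density l)"
    unfolding distributed_def by (auto simp: D_def intro!: distr_id2)
  then have pos: "D.prob {a<..} = exp (- a * l)" if "0 \<le> a" for a
    using D.exponential_distributedD_gt[of "\<lambda>x. x" l a] assms that by (simp add: greaterThan_def)
  have "D.prob {t<..} = exp (- l * max 0 t)"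
  proof (cases "0 \<le> t")
    case True
    then show ?thesis using pos[of t] by (simp add: mult.commute)
  next
    case False
    have "D.prob {0<..} \<le> D.prob {t<..}"
      using False by (intro D.finite_measure_mono) auto
    then show ?thesis using False pos[of 0] D.prob_le_1[of "{t<..}"] by simp
  qed
  then show ?thesis by (simp add: D.emeasure_eq_measure flip: D_def)
qed

text \<open>On the event \<open>A\<close> the variables \<open>X i\<close> are, conditionally, independent exponential variables.\<close>

definition exp_clocks ::
  "'w measure \<Rightarrow> 'w set \<Rightarrow> ('i \<Rightarrow> real) \<Rightarrow> 'i set \<Rightarrow> ('i \<Rightarrow> 'w \<Rightarrow> real) \<Rightarrow> bool" where
  "exp_clocks M A r J X \<longleftrightarrow>
     (\<forall>i\<in>J. X i \<in> borel_measurable M) \<and>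
     (\<forall>K t. finite K \<longrightarrow> K \<subseteq> J \<longrightarrow>
        measure M {\<omega>\<in>A. \<forall>i\<in>K. t i < X i \<omega>} = measure M A * (\<Prod>i\<in>K. exp (- r i * max 0 (t i))))"

lemma exp_clocksD:
  assumes "exp_clocks M A r J X" "finite K" "K \<subseteq> J"
  shows "measure M {\<omega>\<in>A. \<forall>i\<in>K. t i < X i \<omega>} = measure M A * (\<Prod>i\<in>K. exp (- r i * max 0 (t i)))"
  using assms unfolding exp_clocks_def by blast

text \<open>Open rays are closed under intersection and generate the Borel sets, so the product form
  of the joint tails already gives independence under the measure conditioned on \<open>A\<close>,
  and single tails identify each law. The product measure makes Fubini available for the
  race.\<close>

lemma exp_clocks_distr:
  assumes "prob_space M" and A: "A \<in> sets M" "measure M A \<noteq> 0"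
    and clocks: "exp_clocks M A r J X" and I: "finite I" "I \<noteq> {}" "I \<subseteq> J"
    and r: "\<And>i. i \<in> J \<Longrightarrow> 0 < r i"
  shows "distr (uniform_measure M A) (PiM I (\<lambda>_. borel)) (\<lambda>\<omega>. \<lambda>i\<in>I. X i \<omega>) =
    PiM I (\<lambda>i. density lborel (exponential_density (r i)))"
proof -
  interpret prob_space M by fact
  define U where "U = uniform_measure M A"
  have nz: "emeasure M A \<noteq> 0" "emeasure M A \<noteq> \<infinity>"
    using A by (auto simp: emeasure_eq_measure)
  interpret U: prob_space U
    unfolding U_def by (rule prob_space_uniform_measure[OF nz])
  have [simp]: "space U = space M" "sets U = sets M" by (simp_all add: U_def)
  have meas: "X i \<in> borel_measurable U" if "i \<in> I" for i
    using clocks I(3) that by (auto simp: exp_clocks_def cong: measurable_cong_sets)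
  have msets: "X i -` B \<inter> space M \<in> sets M" if "i \<in> I" "B \<in> sets borel" for i B
    using measurable_sets[OF meas[OF that(1)] that(2)] by simp
  have inter: "U.prob (\<Inter>i\<in>K. X i -` {t i<..} \<inter> space M) = (\<Prod>i\<in>K. exp (- r i * max 0 (t i)))"
    if K: "K \<subseteq> I" "K \<noteq> {}" for K t
  proof -
    have fin: "finite K" using K I finite_subset by blast
    have set: "(\<Inter>i\<in>K. X i -` {t i<..} \<inter> space M) \<in> sets M"
      using K fin msets by (intro sets.finite_INT) auto
    have "A \<inter> (\<Inter>i\<in>K. X i -` {t i<..} \<inter> space M) = {\<omega>\<in>A. \<forall>i\<in>K. t i < X i \<omega>}"
      using K(2) sets.sets_into_space[OF A(1)] by auto
    then have "U.prob (\<Inter>i\<in>K. X i -` {t i<..} \<inter> space M) =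
        measure M {\<omega>\<in>A. \<forall>i\<in>K. t i < X i \<omega>} / measure M A"
      unfolding U_def using measure_uniform_measure[OF nz set] by simp
    also have "\<dots> = (\<Prod>i\<in>K. exp (- r i * max 0 (t i)))"
      using exp_clocksD[OF clocks fin, of t] K I A by auto
    finally show ?thesis .
  qed
  have single: "U.prob (X i -` {t<..} \<inter> space M) = exp (- r i * max 0 t)" if "i \<in> I" for i t
    using inter[of "{i}" "\<lambda>_. t"] that by simp
  have dist: "distr U borel (X i) = density lborel (exponential_density (r i))" if "i \<in> I" for i
  proof -
    have "distributed U lborel (X i) (exponential_density (r i))"
    proof (subst U.exponential_distributed_iff)
      show "0 < r i" using that I r by auto
      show "X i \<in> borel_measurable U \<and>
        (\<forall>a\<ge>0. U.prob {x \<in> space U. X i x \<le> a} = 1 - exp (- a * r i))"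
      proof (intro conjI allI impI)
        fix a :: real assume "0 \<le> a"
        have "{x \<in> space U. X i x \<le> a} = space U - (X i -` {a<..} \<inter> space M)" by auto
        moreover have "X i -` {a<..} \<inter> space M \<in> sets U"
          using msets[OF that] by simp
        ultimately show "U.prob {x \<in> space U. X i x \<le> a} = 1 - exp (- a * r i)"
          using single[OF that, of a] \<open>0 \<le> a\<close> U.prob_compl[of "X i -` {a<..} \<inter> space M"]
          by (simp add: mult.commute)
      qed (rule meas[OF that])
    qed
    then show ?thesis
      by (metis distributed_distr_eq_density distr_cong sets_lborel)
  qed
  have "U.indep_vars (\<lambda>_. borel) X I"
    unfolding U.indep_vars_def2
  proof (intro conjI ballI)
    define F where "F i = {X i -` B \<inter> space M | B. B \<in> range greaterThan}" for i
    have "U.indep_sets F I"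
    proof (rule U.indep_setsI)
      fix i assume "i \<in> I"
      then show "F i \<subseteq> U.events" using msets by (auto simp: F_def)
    next
      fix B K assume K: "K \<noteq> {}" "K \<subseteq> I" "finite K" and "\<forall>j\<in>K. B j \<in> F j"
      then have "\<forall>j\<in>K. \<exists>t. B j = X j -` {t<..} \<inter> space M" unfolding F_def by blast
      then obtain t where t: "\<And>j. j \<in> K \<Longrightarrow> B j = X j -` {t j<..} \<inter> space M" by metis
      have "U.prob (\<Inter>j\<in>K. B j) = U.prob (\<Inter>j\<in>K. X j -` {t j<..} \<inter> space M)" using t by simp
      also have "\<dots> = (\<Prod>j\<in>K. exp (- r j * max 0 (t j)))" using K by (intro inter) auto
      also have "\<dots> = (\<Prod>j\<in>K. U.prob (B j))"
        using K by (intro prod.cong) (auto simp: t single)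
      finally show "U.prob (\<Inter>j\<in>K. B j) = (\<Prod>j\<in>K. U.prob (B j))" .
    qed
    then have "U.indep_sets (\<lambda>i. sigma_sets (space U) (F i)) I"
    proof (rule U.indep_sets_sigma)
      fix i
      show "Int_stable (F i)"
      proof (rule Int_stableI)
        fix a b assume "a \<in> F i" "b \<in> F i"
        then obtain s t where "a = X i -` {s<..} \<inter> space M" "b = X i -` {t<..} \<inter> space M"
          by (auto simp: F_def)
        then have "a \<inter> b = X i -` {max s t<..} \<inter> space M" by auto
        then show "a \<inter> b \<in> F i" by (auto simp: F_def)
      qed
    qed
    also have "(\<lambda>i. sigma_sets (space U) (F i)) = (\<lambda>i. {X i -` B \<inter> space U | B. B \<in> sets borel})"
    proof
      fix i
      have "sets (borel :: real measure) = sigma_sets UNIV (range greaterThan)"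
        by (subst borel_Ioi) simp
      then show "sigma_sets (space U) (F i) = {X i -` B \<inter> space U | B. B \<in> sets borel}"
        unfolding F_def using sigma_sets_vimage_commute[of "X i" "space U" UNIV "range greaterThan"]
        by simp
    qed
    finally show "U.indep_sets (\<lambda>i. {X i -` B \<inter> space U | B. B \<in> sets borel}) I" .
  qed (rule meas)
  then have "distr U (PiM I (\<lambda>_. borel)) (\<lambda>\<omega>. \<lambda>i\<in>I. X i \<omega>) = PiM I (\<lambda>i. distr U borel (X i))"
    using U.indep_vars_iff_distr_eq_PiM'[of I X "\<lambda>_. borel"] I(2) meas by simp
  also have "\<dots> = PiM I (\<lambda>i. density lborel (exponential_density (r i)))"
    using dist by (intro PiM_cong) auto
  finally show ?thesis by (simp add: U_def)
qed

text \<open>Tilting the exponential density of rate \<open>l\<close> by \<open>exp (- b * x)\<close>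
  yields \<open>l / (l + b)\<close> times the density of rate \<open>l + b\<close>, which has mass
  one. With \<open>b\<close> the sum of the competing rates this is the chance of winning a
  race.\<close>

lemma exponential_integral_exp:
  assumes "0 < l" "0 < l + b"
  shows "(\<integral>\<^sup>+x. ennreal (exp (- b * x)) \<partial>density lborel (exponential_density l)) = ennreal (l / (l + b))"
proof -
  have "(\<integral>\<^sup>+x. ennreal (exp (- b * x)) \<partial>density lborel (exponential_density l)) =
      (\<integral>\<^sup>+x. ennreal (exponential_density l x) * ennreal (exp (- b * x)) \<partial>lborel)"
    by (subst nn_integral_density) auto
  also have "\<dots> = (\<integral>\<^sup>+x. ennreal (l / (l + b)) * ennreal (exponential_density (l + b) x) \<partial>lborel)"
  proof (intro nn_integral_cong)
    fix x
    have "exponential_density l x * exp (- b * x) = l / (l + b) * exponential_density (l + b) x"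
      using assms by (simp add: exponential_density_def exp_add[symmetric] algebra_simps divide_simps)
    then show "ennreal (exponential_density l x) * ennreal (exp (- b * x)) =
        ennreal (l / (l + b)) * ennreal (exponential_density (l + b) x)"
      using assms by (simp add: ennreal_mult'[symmetric] ennreal_mult''[symmetric])
  qed
  also have "\<dots> = ennreal (l / (l + b)) * (\<integral>\<^sup>+x. ennreal (exponential_density (l + b) x) \<partial>lborel)"
    by (subst nn_integral_cmult) auto
  also have "(\<integral>\<^sup>+x. ennreal (exponential_density (l + b) x) \<partial>lborel) = 1"
    using prob_space.emeasure_space_1[OF prob_space_exponential_density[OF assms(2)]]
    by (simp add: emeasure_density)
  finally show ?thesis by simp
qed

text \<open>Given the value \<open>y\<close> of clock \<open>a\<close>, the tails of the other
  clocks multiply to a product free of \<open>y\<close> times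
  \<open>exp (- sum r (C - {a}) * y)\<close>, and integrating over \<open>y\<close> is a Laplace
  transform. The sign condition on \<open>s\<close> makes \<open>max 0 (s i + y)\<close> split
  additively for the competitors, and \<open>C - {a} \<subseteq> K\<close> puts the whole race into
  the event.\<close>

lemma exp_clocks_race_prob:
  assumes "prob_space M" and A: "A \<in> sets M"
    and clocks: "exp_clocks M A r J X" and r: "\<And>i. i \<in> J \<Longrightarrow> 0 < r i"
    and C: "finite C" "C \<subseteq> J" "a \<in> C"
    and K: "finite K" "K \<subseteq> J - {a}" "C - {a} \<subseteq> K"
    and s: "\<And>i. i \<in> C - {a} \<Longrightarrow> 0 \<le> s i"
  shows "measure M {\<omega>\<in>A. \<forall>i\<in>K. s i + (if i \<in> C then X a \<omega> else 0) < X i \<omega>} =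
    measure M A * (r a / sum r C) * (\<Prod>i\<in>K. exp (- r i * max 0 (s i)))" (is "measure M ?B = _")
proof (cases "measure M A = 0")
  case True
  interpret prob_space M by fact
  have "measure M ?B \<le> measure M A"
    using A by (intro finite_measure_mono) auto
  then show ?thesis using True by (simp add: measure_le_0_iff)
next
  case False
  interpret prob_space M by fact
  define I where "I = insert a K"
  have aK: "a \<notin> K" using K by auto
  have I: "finite I" "I \<noteq> {}" "I \<subseteq> J" using C K by (auto simp: I_def)
  \<comment> \<open>Nothing is known about \<open>r\<close> outside \<open>J\<close>; the default 1
    makes every \<open>D i\<close> a probability measure, as the product locale requires.\<close>
  define D where "D i = density lborel (\<lambda>x. ennreal (exponential_density (if i \<in> J then r i else 1) x))" for i
  have PD: "prob_space (D i)" for i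
    unfolding D_def using r by (intro prob_space_exponential_density) auto
  interpret D: product_prob_space D
    by (intro product_prob_spaceI PD)
  have sD [simp, measurable_cong]: "sets (D i) = sets borel" for i by (simp add: D_def)
  have spD [simp]: "space (D i) = UNIV" for i by (simp add: D_def)
  have meas: "X i \<in> borel_measurable M" if "i \<in> I" for i
    using clocks I(3) that by (auto simp: exp_clocks_def)
  define U where "U = uniform_measure M A"
  have distr: "distr U (PiM I (\<lambda>_. borel)) (\<lambda>\<omega>. \<lambda>i\<in>I. X i \<omega>) = PiM I D"
  proof -
    have "PiM I (\<lambda>i. density lborel (\<lambda>x. ennreal (exponential_density (r i) x))) = PiM I D"
      using I(3) by (intro PiM_cong refl) (auto simp: D_def)
    then show ?thesis
      unfolding U_def using exp_clocks_distr[OF assms(1) A False clocks I r] by simp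
  qed
  define G where "G = {x \<in> space (PiM I (\<lambda>_. borel)). \<forall>i\<in>K. s i + (if i \<in> C then x a else 0) < (x i :: real)}"
  have Gm: "G \<in> sets (PiM I (\<lambda>_. borel))"
    unfolding G_def
  proof (rule sets.sets_Collect_finite_All)
    fix i assume "i \<in> K"
    then have [measurable]: "(\<lambda>x. x i) \<in> borel_measurable (PiM I (\<lambda>_. borel :: real measure))"
      "(\<lambda>x. x a) \<in> borel_measurable (PiM I (\<lambda>_. borel :: real measure))"
      by (auto simp: I_def)
    show "{x \<in> space (PiM I (\<lambda>_. borel)). s i + (if i \<in> C then x a else 0) < (x i :: real)} \<in> sets (PiM I (\<lambda>_. borel))"
      by (cases "i \<in> C") simp_all
  qed fact
  then have Gm': "G \<in> sets (PiM I D)"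
    by (simp cong: sets_PiM_cong)
  have Xm: "(\<lambda>\<omega>. \<lambda>i\<in>I. X i \<omega>) \<in> measurable U (PiM I (\<lambda>_. borel))"
    using meas by (intro measurable_restrict) (auto simp: U_def cong: measurable_cong_sets)
  have nz: "emeasure M A \<noteq> 0" "emeasure M A \<noteq> \<infinity>"
    using False by (auto simp: emeasure_eq_measure)
  interpret U: prob_space U
    unfolding U_def by (rule prob_space_uniform_measure[OF nz])
  define V where "V = (\<lambda>\<omega>. \<lambda>i\<in>I. X i \<omega>) -` G \<inter> space M"
  have V: "V \<in> sets M"
    using measurable_sets[OF Xm Gm] by (simp add: V_def U_def)
  have "A \<inter> V = ?B"
    using sets.sets_into_space[OF A] by (auto simp: V_def G_def I_def space_PiM)
  then have "measure M ?B = measure M A * measure U V"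
    unfolding U_def using measure_uniform_measure[OF nz V] False by simp
  moreover have "emeasure U V = emeasure (PiM I D) G"
    unfolding distr[symmetric] V_def using emeasure_distr[OF Xm Gm] by (simp add: U_def)
  moreover have "emeasure (PiM I D) G =
      ennreal ((r a / sum r C) * (\<Prod>i\<in>K. exp (- r i * max 0 (s i))))"
  proof -
    have spl: "ennreal (exp (- r i * max 0 (s i + (if i \<in> C then max 0 y else 0)))) =
       ennreal (exp (- r i * max 0 (s i))) * ennreal (exp (- (if i \<in> C then r i * max 0 y else 0)))"
      if "i \<in> K" for i and y :: real
    proof -
      have "max 0 (s i + max 0 y) = max 0 (s i) + max 0 y" if "i \<in> C"
        using s[of i] \<open>i \<in> K\<close> that aK by fastforce
      then show ?thesis by (auto simp: ennreal_mult[symmetric] exp_add[symmetric] algebra_simps)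
    qed
    have sumC: "(\<Sum>i\<in>K. if i \<in> C then r i * y else 0) = sum r (C - {a}) * y" for y
    proof -
      have "K \<inter> C = C - {a}" using K by auto
      then show ?thesis
        using K(1) by (simp add: sum.inter_restrict[symmetric] sum_distrib_right)
    qed
    \<comment> \<open>With clock \<open>a\<close> frozen at \<open>y\<close>, the event is a box in
      the remaining coordinates.\<close>
    have slice: "(\<integral>\<^sup>+x. indicator G (x(a := y)) \<partial>PiM K D) =
        ennreal (\<Prod>i\<in>K. exp (- r i * max 0 (s i))) * ennreal (exp (- sum r (C - {a}) * y))"
      if "0 \<le> y" for y
    proof -
      have "(\<integral>\<^sup>+x. indicator G (x(a := y)) \<partial>PiM K D) =
          (\<integral>\<^sup>+x. indicator (Pi\<^sub>E K (\<lambda>i. {s i + (if i \<in> C then y else 0)<..})) x \<partial>PiM K D)"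
        using aK by (intro nn_integral_cong)
          (auto simp: G_def I_def space_PiM indicator_def PiE_iff extensional_def)
      also have "\<dots> = emeasure (PiM K D) (Pi\<^sub>E K (\<lambda>i. {s i + (if i \<in> C then y else 0)<..}))"
        using K by (intro nn_integral_indicator sets_PiM_I_finite) auto
      also have "\<dots> = (\<Prod>i\<in>K. emeasure (D i) {s i + (if i \<in> C then y else 0)<..})"
        using K by (intro D.emeasure_PiM) auto
      also have "\<dots> = (\<Prod>i\<in>K. ennreal (exp (- r i * max 0 (s i + (if i \<in> C then max 0 y else 0)))))"
        using that K by (intro prod.cong refl) (auto simp: D_def exponential_tail r)
      also have "\<dots> = (\<Prod>i\<in>K. ennreal (exp (- r i * max 0 (s i))) * ennreal (exp (- (if i \<in> C then r i * max 0 y else 0))))"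
        by (intro prod.cong refl spl)
      also have "\<dots> = (\<Prod>i\<in>K. ennreal (exp (- r i * max 0 (s i)))) * (\<Prod>i\<in>K. ennreal (exp (- (if i \<in> C then r i * y else 0))))"
        by (simp add: prod.distrib max_absorb2[OF that] cong: if_cong)
      also have "(\<Prod>i\<in>K. ennreal (exp (- (if i \<in> C then r i * y else 0)))) = ennreal (exp (- sum r (C - {a}) * y))"
        using K(1) by (simp add: prod_ennreal exp_sum[symmetric] sum_negf sumC)
      also have "(\<Prod>i\<in>K. ennreal (exp (- r i * max 0 (s i)))) = ennreal (\<Prod>i\<in>K. exp (- r i * max 0 (s i)))"
        by (intro prod_ennreal) simp
      finally show ?thesis .
    qed
    have pos: "AE y in D a. 0 \<le> y"
      unfolding D_def by (subst AE_density) (auto simp: exponential_density_def)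
    have ra: "0 < r a" "0 \<le> sum r (C - {a})" "sum r C = r a + sum r (C - {a})"
      using C r by (auto intro!: sum_nonneg simp: sum.remove less_imp_le)
    have "emeasure (PiM I D) G = (\<integral>\<^sup>+x. indicator G x \<partial>PiM I D)"
      using Gm' by simp
    also have "\<dots> = (\<integral>\<^sup>+y. (\<integral>\<^sup>+x. indicator G (x(a := y)) \<partial>PiM K D) \<partial>D a)"
      unfolding I_def using K(1) aK Gm' by (intro D.product_nn_integral_insert_rev) (auto simp: I_def)
    also have "\<dots> = (\<integral>\<^sup>+y. ennreal (\<Prod>i\<in>K. exp (- r i * max 0 (s i))) * ennreal (exp (- sum r (C - {a}) * y)) \<partial>D a)"
      by (rule nn_integral_cong_AE) (use pos in eventually_elim, rule slice)
    also have "\<dots> = ennreal (\<Prod>i\<in>K. exp (- r i * max 0 (s i))) * (\<integral>\<^sup>+y. ennreal (exp (- sum r (C - {a}) * y)) \<partial>D a)"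
      by (intro nn_integral_cmult) (auto simp: D_def)
    also have "(\<integral>\<^sup>+y. ennreal (exp (- sum r (C - {a}) * y)) \<partial>D a) = ennreal (r a / sum r C)"
      unfolding D_def using C ra by (subst exponential_integral_exp) auto
    finally show ?thesis
      using ra by (simp add: ennreal_mult[symmetric] prod_nonneg mult.commute)
  qed
  ultimately show ?thesis
    using C r by (simp add: U.emeasure_eq_measure prod_nonneg sum_nonneg less_imp_le subset_iff mult.assoc)
qed

text \<open>Memorylessness for one birth: \<open>C\<close> stands for the running clocks, of which
  \<open>a\<close> rings first. The overshoots of the other running clocks and the clocks not yet
  started keep the product form with the same rates, because the race probability splits off as a
  factor.\<close>

lemma exp_clocks_race:
  fixes r :: "'i \<Rightarrow> real"
  assumes M: "prob_space M" and A: "A \<in> sets M"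
    and clocks: "exp_clocks M A r J X" and r: "\<And>i. i \<in> J \<Longrightarrow> 0 < r i"
    and C: "finite C" "C \<subseteq> J" "a \<in> C"
  defines "B \<equiv> {\<omega>\<in>A. \<forall>i\<in>C - {a}. X a \<omega> < X i \<omega>}"
  shows "measure M B = measure M A * (r a / sum r C)"
    and "exp_clocks M B r (J - {a}) (\<lambda>i \<omega>. if i \<in> C then X i \<omega> - X a \<omega> else X i \<omega>)"
proof -
  note race = exp_clocks_race_prob[OF M A clocks r C]
  have "B = {\<omega>\<in>A. \<forall>i\<in>C - {a}. 0 + (if i \<in> C then X a \<omega> else 0) < X i \<omega>}"
    by (auto simp: B_def)
  then show B: "measure M B = measure M A * (r a / sum r C)"
    using race[of "C - {a}" "\<lambda>_. 0"] C by auto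
  have meas: "X i \<in> borel_measurable M" if "i \<in> J" for i
    using clocks that by (auto simp: exp_clocks_def)
  show "exp_clocks M B r (J - {a}) (\<lambda>i \<omega>. if i \<in> C then X i \<omega> - X a \<omega> else X i \<omega>)"
    unfolding exp_clocks_def
  proof (intro conjI ballI allI impI)
    fix i assume "i \<in> J - {a}"
    then show "(\<lambda>\<omega>. if i \<in> C then X i \<omega> - X a \<omega> else X i \<omega>) \<in> borel_measurable M"
      using meas C by (cases "i \<in> C") auto
  next
    fix K and t :: "'i \<Rightarrow> real"
    assume K: "finite K" "K \<subseteq> J - {a}"
    \<comment> \<open>One threshold encodes both demands on a competitor: to lose the race and to
      overshoot by \<open>t i\<close>. Losing already means a positive overshoot, so a negative
      \<open>t i\<close> is raised to 0, and competitors outside \<open>K\<close> get 0.\<close>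
    define s where "s i = (if i \<in> K then if i \<in> C then max 0 (t i) else t i else 0)" for i
    have max_s: "max 0 (s i) = (if i \<in> K then max 0 (t i) else 0)" for i by (auto simp: s_def)
    have iff: "(i \<in> C \<longrightarrow> X a \<omega> < X i \<omega>) \<and> (i \<in> K \<longrightarrow> t i < (if i \<in> C then X i \<omega> - X a \<omega> else X i \<omega>)) \<longleftrightarrow>
        s i + (if i \<in> C then X a \<omega> else 0) < X i \<omega>" if "i \<in> K \<union> (C - {a})" for i \<omega>
      using that by (cases "i \<in> C"; cases "i \<in> K") (auto simp: s_def max_def)
    have "{\<omega>\<in>B. \<forall>i\<in>K. t i < (if i \<in> C then X i \<omega> - X a \<omega> else X i \<omega>)} =
        {\<omega>\<in>A. \<forall>i\<in>K \<union> (C - {a}). (i \<in> C \<longrightarrow> X a \<omega> < X i \<omega>) \<and>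
           (i \<in> K \<longrightarrow> t i < (if i \<in> C then X i \<omega> - X a \<omega> else X i \<omega>))}"
      using K unfolding B_def by blast
    also have "\<dots> = {\<omega>\<in>A. \<forall>i\<in>K \<union> (C - {a}). s i + (if i \<in> C then X a \<omega> else 0) < X i \<omega>}"
      using iff by blast
    finally have "{\<omega>\<in>B. \<forall>i\<in>K. t i < (if i \<in> C then X i \<omega> - X a \<omega> else X i \<omega>)} =
        {\<omega>\<in>A. \<forall>i\<in>K \<union> (C - {a}). s i + (if i \<in> C then X a \<omega> else 0) < X i \<omega>}" .
    then have "measure M {\<omega>\<in>B. \<forall>i\<in>K. t i < (if i \<in> C then X i \<omega> - X a \<omega> else X i \<omega>)} =
        measure M B * (\<Prod>i\<in>K \<union> (C - {a}). exp (- r i * max 0 (s i)))"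
      unfolding B using K C by (simp only:) (intro race, auto simp: s_def)
    also have "(\<Prod>i\<in>K \<union> (C - {a}). exp (- r i * max 0 (s i))) = (\<Prod>i\<in>K. exp (- r i * max 0 (t i)))"
      using K C by (intro prod.mono_neutral_cong_right) (auto simp: max_s)
    finally show "measure M {\<omega>\<in>B. \<forall>i\<in>K. t i < (if i \<in> C then X i \<omega> - X a \<omega> else X i \<omega>)} =
        measure M B * (\<Prod>i\<in>K. exp (- r i * max 0 (t i)))" .
  qed
qed

section \<open>Histories of the branching process\<close>

lemma born_before_trans: "born_before e x y \<Longrightarrow> born_before e y z \<Longrightarrow> born_before e x z"
  by (auto simp: born_before_def)

lemma born_before_irrefl: "\<not> born_before e x x"
  by (simp add: born_before_def)

lemma born_before_total: "x = y \<or> born_before e x y \<or> born_before e y x"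
  unfolding born_before_def by (metis linorder_neqE_linordered_idom linorder_neqE_nat to_nat_split)

text \<open>Of two individuals the earlier has the strictly smaller set of predecessors, so the rank
  determines the individual. The same uniqueness later makes the THE in \<open>individual\<close>
  measurable.\<close>

lemma individual_unique:
  assumes "finite {y. born_before e y x}" "finite {y. born_before e y z}"
    and "card {y. born_before e y x} = card {y. born_before e y z}"
  shows "x = z"
proof -
  have less: "card {y. born_before e y x} < card {y. born_before e y z}"
    if "born_before e x z" "finite {y. born_before e y z}" for x z
  proof (rule psubset_card_mono)
    show "{y. born_before e y x} \<subset> {y. born_before e y z}"
      using that(1) born_before_trans[of e _ x z] born_before_irrefl[of e x] by blast
  qed fact
  show ?thesis
    using born_before_total[of x z e] less[of x z] less[of z x] assms by auto
qed

lemma individual_eqI: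
  assumes "finite {y. born_before e y x}" "Suc (card {y. born_before e y x}) = n"
  shows "individual e n = x"
  unfolding individual_def
  by (rule the_equality) (use assms in \<open>auto intro!: individual_unique[of e]\<close>)

text \<open>
  A list \<open>ps\<close> records a history of the branching process: its head is the parent of the individual
  \<open>length ps\<close>, its next entry the parent of the individual \<open>length ps - 1\<close>, and so on.  Here the
  individuals are numbered from \<open>0\<close>, so that \<open>i\<close> corresponds to \<open>individual e (Suc i)\<close>.
\<close>

primrec parent_list :: "nat list \<Rightarrow> bool" where
  "parent_list [] \<longleftrightarrow> True"
| "parent_list (p # ps) \<longleftrightarrow> p \<le> length ps \<and> parent_list ps"

text \<open>Translates numbers in a history into ancestry names. Children of \<open>p\<close> are
  born in the order of their indices, so the newborn's index is the number of earlier children of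
  \<open>p\<close>. Beyond \<open>length ps\<close> the value is the default
  \<open>[]\<close>.\<close>

primrec node :: "nat list \<Rightarrow> nat \<Rightarrow> nat list" where
  "node [] = (\<lambda>_. [])"
| "node (p # ps) = (node ps)(Suc (length ps) := count_list ps p # node ps p)"

definition next_child :: "nat list \<Rightarrow> nat \<Rightarrow> nat list" where
  "next_child ps i = count_list ps i # node ps i"

definition nodes :: "nat list \<Rightarrow> nat list set" where
  "nodes ps = node ps ` {..length ps}"

lemma nodes_Nil [simp]: "nodes [] = {[]}"
  by (simp add: nodes_def)

lemma nodes_Cons: "nodes (p # ps) = insert (next_child ps p) (nodes ps)"
proof -
  have "node (p # ps) ` {..length ps} = node ps ` {..length ps}"
    by (intro image_cong) auto
  then show ?thesis
    by (simp add: nodes_def next_child_def atMost_Suc del: node.simps) simp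
qed

lemma node_in_nodes: "i \<le> length ps \<Longrightarrow> node ps i \<in> nodes ps"
  by (simp add: nodes_def)

lemma parent_list_less: "parent_list ps \<Longrightarrow> p \<in> set ps \<Longrightarrow> p < length ps"
  by (induction ps) auto

lemma count_list_new: "parent_list ps \<Longrightarrow> length ps \<le> i \<Longrightarrow> count_list ps i = 0"
  by (metis count_notin not_less parent_list_less)

lemma Nil_in_nodes: "[] \<in> nodes ps"
  by (induction ps) (auto simp: nodes_Cons)

lemma nodes_closed: "parent_list ps \<Longrightarrow> k # x \<in> nodes ps \<Longrightarrow> x \<in> nodes ps"
  by (induction ps) (auto simp: nodes_Cons next_child_def node_in_nodes)

text \<open>The two claims need each other in the induction: the description of children shows that
  the newborn's name is fresh, which preserves injectivity, and injectivity shows that this name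
  belongs to \<open>p\<close> alone.\<close>

lemma node_structure:
  assumes "parent_list ps"
  shows "inj_on (node ps) {..length ps} \<and>
    (\<forall>i\<le>length ps. \<forall>k. k # node ps i \<in> nodes ps \<longleftrightarrow> k < count_list ps i)"
  using assms
proof (induction ps)
  case (Cons p ps)
  then have p: "p \<le> length ps" and ps: "parent_list ps"
    and inj: "inj_on (node ps) {..length ps}"
    and children: "\<And>i k. i \<le> length ps \<Longrightarrow> k # node ps i \<in> nodes ps \<longleftrightarrow> k < count_list ps i"
    by auto
  have new: "next_child ps p \<notin> nodes ps"
    using children[OF p] by (simp add: next_child_def)
  have inj': "inj_on (node (p # ps)) {..length (p # ps)}"
  proof -
    have "inj_on (node (p # ps)) {..length ps}"
      using inj by (rule inj_on_cong[THEN iffD1, rotated]) auto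
    moreover have "node (p # ps) ` {..length ps} = nodes ps"
      unfolding nodes_def by (intro image_cong) auto
    ultimately show ?thesis
      using new by (simp add: atMost_Suc next_child_def del: node.simps)
        (simp add: inj_on_insert next_child_def)
  qed
  have "k # node (p # ps) i \<in> nodes (p # ps) \<longleftrightarrow> k < count_list (p # ps) i"
    if "i \<le> length (p # ps)" for i k
  proof (cases "i = Suc (length ps)")
    case True
    \<comment> \<open>The names are closed under taking parents, so a name that is absent has no
      child among them.\<close>
    have "k # next_child ps p \<notin> nodes ps" using nodes_closed[OF ps] new by blast
    then show ?thesis
      using True count_list_new[OF Cons.prems, of i] p count_list_new[OF ps, of i]
      by (simp add: nodes_Cons next_child_def)
  next
    case False
    then have i: "i \<le> length ps" using that by simp
    have "k # node ps i = next_child ps p \<longleftrightarrow> i = p \<and> k = count_list ps p"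
      using inj i p by (auto simp: next_child_def inj_on_def)
    then show ?thesis using False children[OF i, of k] by (auto simp: nodes_Cons)
  qed
  then show ?case using inj' by blast
qed auto

lemma inj_node: "parent_list ps \<Longrightarrow> i \<le> length ps \<Longrightarrow> j \<le> length ps \<Longrightarrow> node ps i = node ps j \<longleftrightarrow> i = j"
  using node_structure[of ps] by (auto simp: inj_on_def)

lemma child_in_nodes_iff:
  "parent_list ps \<Longrightarrow> i \<le> length ps \<Longrightarrow> k # node ps i \<in> nodes ps \<longleftrightarrow> k < count_list ps i"
  using node_structure[of ps] by blast

text \<open>The first \<open>length ps + 1\<close> individuals in order of birth have the history \<open>ps\<close>.\<close>

primrec history_event :: "'w set \<Rightarrow> (nat list \<Rightarrow> nat \<Rightarrow> 'w \<Rightarrow> real) \<Rightarrow> nat list \<Rightarrow> 'w set" where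
  "history_event S E [] = S"
| "history_event S E (p # ps) = {\<omega> \<in> history_event S E ps. \<forall>i\<le>length ps. i \<noteq> p \<longrightarrow>
     birth_time (\<lambda>x k. E x k \<omega>) (next_child ps p) < birth_time (\<lambda>x k. E x k \<omega>) (next_child ps i)}"

text \<open>The second conjunct is the invariant that keeps the order going: each candidate for the
  next birth comes after the last one. It survives a birth because the newborn's first child and the
  next child of \<open>p\<close> come a positive holding time later, and the other candidates lost
  the race.\<close>

lemma history_order:
  assumes "parent_list ps" "\<omega> \<in> history_event S E ps" "\<And>x k. 0 < E x k \<omega>"
  defines "b \<equiv> birth_time (\<lambda>x k. E x k \<omega>)"
  shows "(\<forall>i\<le>length ps. \<forall>j\<le>length ps. i < j \<longrightarrow> b (node ps i) < b (node ps j)) \<and>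
    (\<forall>i\<le>length ps. b (node ps (length ps)) < b (next_child ps i))"
  using assms(1,2)
proof (induction ps)
  case Nil
  show ?case using assms(3) by (simp add: b_def next_child_def jump_time_def)
next
  case (Cons p ps)
  then have p: "p \<le> length ps" and ps: "parent_list ps"
    and sorted: "\<And>i j. j \<le> length ps \<Longrightarrow> i < j \<Longrightarrow> b (node ps i) < b (node ps j)"
    and latest: "\<And>i. i \<le> length ps \<Longrightarrow> b (node ps (length ps)) < b (next_child ps i)"
    and first: "\<And>i. i \<le> length ps \<Longrightarrow> i \<noteq> p \<Longrightarrow> b (next_child ps p) < b (next_child ps i)"
    by (auto simp: b_def)
  have before_new: "b (node ps i) < b (next_child ps p)" if "i \<le> length ps" for i
    using sorted[of "length ps" i] latest[OF p] that by (cases "i = length ps") auto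
  have after_new: "b (next_child ps p) < b (next_child (p # ps) i)" if "i \<le> length (p # ps)" for i
  proof -
    consider "i = Suc (length ps)" | "i = p" | "i \<le> length ps" "i \<noteq> p" using \<open>i \<le> length (p # ps)\<close> by force
    then show ?thesis
    proof cases
      case 1
      have "count_list (p # ps) i = 0" using 1 count_list_new[OF Cons.prems(1), of i] by simp
      then show ?thesis
        using 1 assms(3) unfolding next_child_def[of "p # ps"] by (simp add: b_def jump_time_def next_child_def)
    next
      case 2
      then show ?thesis
        using p assms(3) by (simp add: next_child_def b_def jump_time_def)
    next
      case 3
      then have "next_child (p # ps) i = next_child ps i" by (simp add: next_child_def)
      then show ?thesis using first 3 by simp
    qed
  qed
  show ?case
    using sorted before_new after_new
    by (auto simp: le_Suc_eq next_child_def[of ps, symmetric] simp del: birth_time.simps)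
qed

text \<open>Anyone outside the history is born after its last member. Going up the ancestry, such an
  individual either has a parent outside, and is born later than that parent, or is a child of a
  member and not born before the next child of that member. Hence the predecessors of
  \<open>node ps i\<close> are exactly the nodes with smaller numbers.\<close>

lemma history_individual:
  assumes ps: "parent_list ps" and \<omega>: "\<omega> \<in> history_event S E ps" and pos: "\<And>x k. 0 < E x k \<omega>"
    and i: "i \<le> length ps"
  shows "individual (\<lambda>x k. E x k \<omega>) (Suc i) = node ps i"
proof -
  define e where "e = (\<lambda>x k. E x k \<omega>)"
  have pos_e: "0 < e x k" for x k using pos by (simp add: e_def)
  have jump_mono: "jump_time (e x) k \<le> jump_time (e x) l" if "k \<le> l" for x k l
    unfolding jump_time_def using pos_e that by (intro sum_mono2) (auto intro: less_imp_le)
  have jump_pos: "0 < jump_time (e x) k" for x k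
    unfolding jump_time_def using pos_e by (intro sum_pos) auto
  have sorted: "\<And>i j. j \<le> length ps \<Longrightarrow> i < j \<Longrightarrow> birth_time e (node ps i) < birth_time e (node ps j)"
    and latest: "\<And>i. i \<le> length ps \<Longrightarrow> birth_time e (node ps (length ps)) < birth_time e (next_child ps i)"
    using history_order[of ps \<omega> S E, OF ps \<omega> pos] unfolding e_def by auto
  have outside: "birth_time e (node ps (length ps)) < birth_time e x" if "x \<notin> nodes ps" for x
    using that
  proof (induction x)
    case Nil
    then show ?case by (simp add: Nil_in_nodes)
  next
    case (Cons k y)
    show ?case
    proof (cases "y \<in> nodes ps")
      case True
      then obtain l where l: "l \<le> length ps" "y = node ps l" by (auto simp: nodes_def)
      then have "count_list ps l \<le> k"
        using Cons.prems child_in_nodes_iff[OF ps l(1), of k] by simp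
      then show ?thesis
        using latest[OF l(1)] jump_mono[of "count_list ps l" k y] l(2) by (simp add: next_child_def)
    next
      case False
      then show ?thesis using Cons.IH jump_pos[of y k] by simp
    qed
  qed
  have "{y. born_before e y (node ps i)} = node ps ` {..<i}"
  proof (intro set_eqI iffI)
    fix y assume y: "y \<in> {y. born_before e y (node ps i)}"
    then have le: "birth_time e y \<le> birth_time e (node ps i)" by (auto simp: born_before_def)
    also have "\<dots> \<le> birth_time e (node ps (length ps))"
      using sorted[of "length ps" i] i by (cases "i = length ps") auto
    finally have "y \<in> nodes ps" using outside[of y] by force
    then obtain l where l: "l \<le> length ps" "y = node ps l" by (auto simp: nodes_def)
    have "l \<noteq> i" using y l by (auto simp: born_before_irrefl)
    moreover have "\<not> i < l" using sorted[of l i] l le by auto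
    ultimately show "y \<in> node ps ` {..<i}" using l by auto
  next
    fix y assume "y \<in> node ps ` {..<i}"
    then show "y \<in> {y. born_before e y (node ps i)}"
      using sorted[OF i] by (auto simp: born_before_def)
  qed
  moreover have "inj_on (node ps) {..<i}"
    using ps i by (auto simp: inj_on_def inj_node)
  ultimately have "individual e (Suc i) = node ps i"
    by (intro individual_eqI) (auto simp: card_image)
  then show ?thesis by (simp add: e_def)
qed

lemma birth_count_eqI:
  assumes "\<And>i. 0 < s i" "0 \<le> t" "(\<Sum>i<k. s i) \<le> t" "t < (\<Sum>i\<le>k. s i)"
  shows "birth_count s t = k"
proof -
  have mono: "(\<Sum>i<a. s i) \<le> (\<Sum>i<b. s i)" if "a \<le> b" for a b
    using assms(1) that by (intro sum_mono2) (auto intro: less_imp_le)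
  have "(LEAST k. t \<in> {(\<Sum>i<k. s i) ..< (\<Sum>i\<le>k. s i)}) = k"
  proof (rule Least_equality)
    fix l assume l: "t \<in> {(\<Sum>i<l. s i) ..< (\<Sum>i\<le>l. s i)}"
    then show "k \<le> l"
      using mono[of "Suc l" k] assms(3) by (cases "l < k") (auto simp: lessThan_Suc_atMost)
  qed (use assms in auto)
  then show ?thesis using assms(2) by (simp add: birth_count_def)
qed

text \<open>The latest recorded child of \<open>i\<close> is itself a node, hence born by the time
  of the last birth, while the next child is born after it.\<close>

lemma history_birth_count:
  assumes ps: "parent_list ps" and \<omega>: "\<omega> \<in> history_event S E ps" and pos: "\<And>x k. 0 < E x k \<omega>"
    and i: "i \<le> length ps"
  defines "e \<equiv> \<lambda>x k. E x k \<omega>"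
  shows "birth_count (e (node ps i)) (birth_time e (node ps (length ps)) - birth_time e (node ps i)) =
    count_list ps i"
proof -
  have sorted: "\<And>i j. j \<le> length ps \<Longrightarrow> i < j \<Longrightarrow> birth_time e (node ps i) < birth_time e (node ps j)"
    and latest: "\<And>i. i \<le> length ps \<Longrightarrow> birth_time e (node ps (length ps)) < birth_time e (next_child ps i)"
    using history_order[of ps \<omega> S E, OF ps \<omega> pos] unfolding e_def by auto
  have last: "birth_time e (node ps j) \<le> birth_time e (node ps (length ps))" if "j \<le> length ps" for j
    using sorted[of "length ps" j] that by (cases "j = length ps") auto
  show ?thesis
  proof (rule birth_count_eqI)
    show "(\<Sum>k<count_list ps i. e (node ps i) k) \<le> birth_time e (node ps (length ps)) - birth_time e (node ps i)"
    proof (cases "count_list ps i")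
      case 0
      then show ?thesis using last[OF i] by simp
    next
      case (Suc k)
      then have "k # node ps i \<in> nodes ps" using child_in_nodes_iff[OF ps i] by simp
      then obtain j where "j \<le> length ps" "node ps j = k # node ps i" by (force simp: nodes_def)
      then show ?thesis using last[of j] Suc by (simp add: jump_time_def lessThan_Suc_atMost)
    qed
    show "birth_time e (node ps (length ps)) - birth_time e (node ps i) < (\<Sum>k\<le>count_list ps i. e (node ps i) k)"
      using latest[OF i] by (simp add: next_child_def jump_time_def)
  qed (use last[OF i] pos in \<open>auto simp: e_def\<close>)
qed

section \<open>The degree counts along a random history\<close>

definition histories :: "nat \<Rightarrow> nat list set" where
  "histories L = {ps. parent_list ps \<and> length ps = L}"

lemma histories_0 [simp]: "histories 0 = {[]}"
  by (auto simp: histories_def)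

lemma histories_Suc: "histories (Suc L) = (\<lambda>(p, ps). p # ps) ` ({..L} \<times> histories L)"
  by (force simp: histories_def length_Suc_conv)

lemma finite_histories [simp]: "finite (histories L)"
  by (induction L) (auto simp: histories_Suc)

lemma sum_histories_Suc:
  "(\<Sum>qs\<in>histories (Suc L). f qs) = (\<Sum>ps\<in>histories L. \<Sum>p\<le>L. f (p # ps))"
proof -
  have "inj_on (\<lambda>(p, ps). p # ps) ({..L} \<times> histories L)" by (auto simp: inj_on_def)
  then have "(\<Sum>qs\<in>histories (Suc L). f qs) = (\<Sum>(p, ps)\<in>{..L} \<times> histories L. f (p # ps))"
    unfolding histories_Suc by (subst sum.reindex) (auto simp: case_prod_unfold)
  also have "\<dots> = (\<Sum>p\<le>L. \<Sum>ps\<in>histories L. f (p # ps))" by (simp add: sum.cartesian_product)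
  finally show ?thesis by (subst (asm) sum.swap)
qed

text \<open>Probability of a history when an individual with \<open>k\<close> children gives birth at rate \<open>r k\<close>.\<close>

primrec history_prob :: "(nat \<Rightarrow> real) \<Rightarrow> nat list \<Rightarrow> real" where
  "history_prob r [] = 1"
| "history_prob r (p # ps) =
     history_prob r ps * (r (count_list ps p) / (\<Sum>i\<le>length ps. r (count_list ps i)))"

lemma history_prob_nonneg:
  assumes "\<And>k. 0 < r k"
  shows "0 \<le> history_prob r ps"
proof (induction ps)
  case (Cons p ps)
  have "0 \<le> r (count_list ps p) / (\<Sum>i\<le>length ps. r (count_list ps i))"
    by (intro divide_nonneg_nonneg sum_nonneg less_imp_le assms)
  then show ?case
    unfolding history_prob.simps by (intro mult_nonneg_nonneg Cons.IH)
qed simp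

text \<open>The rates of one step add up to its denominator. Besides normalising expectations over
  histories, this shows later that the history events of one length exhaust the space up to a null
  set.\<close>

lemma sum_history_prob:
  assumes "\<And>k. 0 < r k"
  shows "(\<Sum>ps\<in>histories L. history_prob r ps) = 1"
proof (induction L)
  case (Suc L)
  have "(\<Sum>p\<le>L. history_prob r (p # ps)) = history_prob r ps" if "ps \<in> histories L" for ps
  proof -
    have "0 < (\<Sum>i\<le>L. r (count_list ps i))" using assms by (intro sum_pos) auto
    then show ?thesis
      using that by (simp add: histories_def sum_distrib_left[symmetric] sum_divide_distrib[symmetric])
  qed
  then show ?case by (simp add: sum_histories_Suc Suc del: history_prob.simps)
qed simp

text \<open>Vertices are counted from 0 here, like individuals in a history: \<open>v\<close> stands
  for vertex \<open>v + 1\<close> of the collapsed process, and individual \<open>p\<close> is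
  merged into \<open>p div m\<close>. Individuals not yet born contribute 0.\<close>

definition vertex_degree :: "nat \<Rightarrow> nat list \<Rightarrow> nat \<Rightarrow> nat" where
  "vertex_degree m ps v = (\<Sum>i<m. count_list ps (m * v + i))"

lemma vertex_degree_Cons:
  assumes "0 < m"
  shows "vertex_degree m (p # ps) v = vertex_degree m ps v + of_bool (p div m = v)"
proof -
  have "(\<Sum>i<m. of_bool (p = m * v + i)) = (of_bool (p div m = v) :: nat)"
  proof (cases "p div m = v")
    case True
    have "p = m * v + i \<longleftrightarrow> i = p mod m" for i
      using True by (metis add_left_cancel mult_div_mod_eq)
    then show ?thesis using True assms by (simp add: of_bool_def sum.delta)
  next
    case False
    then have "p \<noteq> m * v + i" if "i < m" for i using that by auto
    then show ?thesis using False by simp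
  qed
  moreover have "count_list (p # ps) i = count_list ps i + of_bool (p = i)" for i by simp
  ultimately show ?thesis by (simp add: vertex_degree_def sum.distrib del: count_list.simps)
qed

text \<open>The range consists of the vertices whose first individual is born, so the last one may
  be incomplete.\<close>

definition degree_count :: "nat \<Rightarrow> nat \<Rightarrow> nat list \<Rightarrow> real" where
  "degree_count m k ps = (\<Sum>v\<le>length ps div m. of_bool (vertex_degree m ps v = k))"

text \<open>A birth lifts only the vertex of the parent, from \<open>d\<close> to
  \<open>d + 1\<close>. The newborn opens a vertex, of degree 0, exactly if its number
  \<open>Suc (length ps)\<close> is a multiple of \<open>m\<close>.\<close>

lemma degree_count_Cons:
  assumes m: "0 < m" and ps: "parent_list (p # ps)"
  defines "d \<equiv> vertex_degree m ps (p div m)"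
  shows "degree_count m k (p # ps) = degree_count m k ps + of_bool (Suc d = k) - of_bool (d = k)
    + of_bool (k = 0 \<and> m dvd Suc (length ps))"
proof -
  define n where "n = length ps div m"
  have p: "p div m \<le> n" using ps by (simp add: n_def div_le_mono)
  have old: "(\<Sum>v\<le>n. of_bool (vertex_degree m (p # ps) v = k)) =
      degree_count m k ps + of_bool (Suc d = k) - of_bool (d = k)"
    unfolding degree_count_def n_def[symmetric]
    using p by (subst (1 2) sum.remove[of _ "p div m"]) (auto simp: vertex_degree_Cons[OF m] d_def)
  have new: "vertex_degree m (p # ps) (Suc n) = 0"
  proof -
    have "length ps < m * Suc n"
      using m by (simp add: n_def) (metis dividend_less_times_div mult_Suc_right add.commute)
    then have "vertex_degree m ps (Suc n) = 0"
      using ps by (auto simp: vertex_degree_def intro!: count_list_new)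
    then show ?thesis using p by (simp add: vertex_degree_Cons[OF m])
  qed
  show ?thesis
  proof (cases "m dvd Suc (length ps)")
    case True
    then have "Suc (length ps) div m = Suc n" by (simp add: n_def div_Suc mod_eq_0_iff_dvd)
    then show ?thesis
      unfolding degree_count_def[of m k "p # ps"] using True new old by auto
  next
    case False
    then have "Suc (length ps) div m = n" by (simp add: n_def div_Suc mod_eq_0_iff_dvd)
    then show ?thesis
      unfolding degree_count_def[of m k "p # ps"] using False old by auto
  qed
qed

text \<open>Everyone but the initial individual is the child of exactly one individual, so the total
  rate depends on the history only through its length.\<close>

lemma sum_weights:
  fixes c :: real
  assumes "parent_list ps"
  shows "(\<Sum>i\<le>length ps. real (count_list ps i) + c) = real (length ps) + (real (length ps) + 1) * c"
proof -
  have "(\<Sum>i\<le>length ps. count_list ps i) = length ps"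
    using parent_list_less[OF assms] by (intro sum_count_set) (auto intro: less_imp_le)
  then show ?thesis
    by (simp add: sum.distrib flip: of_nat_sum)
qed

text \<open>The error is due to the last vertex, which may still be incomplete.\<close>

lemma degree_weight:
  fixes c :: real
  assumes m: "0 < m" and c: "0 \<le> c" and ps: "parent_list ps"
  shows "\<bar>(\<Sum>p\<le>length ps. (count_list ps p + c) * of_bool (vertex_degree m ps (p div m) = k)) -
    (k + m * c) * degree_count m k ps\<bar> \<le> m * c"
proof -
  define L where "L = length ps"
  define n where "n = L div m"
  define f where "f p = (count_list ps p + c) * of_bool (vertex_degree m ps (p div m) = k)" for p
  have L: "L < Suc n * m"
    using m by (simp add: n_def) (metis dividend_less_times_div mult.commute)
  have "(\<Sum>p\<in>{m * v..<m * v + m}. f p) = (k + m * c) * of_bool (vertex_degree m ps v = k)" for v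
  proof -
    have "(\<Sum>p\<in>{m * v..<m * v + m}. f p) = (\<Sum>i<m. f (m * v + i))"
      using sum.shift_bounds_nat_ivl[of f 0 "m * v" m] by (simp add: add.commute lessThan_atLeast0)
    also have "\<dots> = (\<Sum>i<m. (count_list ps (m * v + i) + c) * of_bool (vertex_degree m ps v = k))"
      by (intro sum.cong) (auto simp: f_def)
    also have "\<dots> = (vertex_degree m ps v + m * c) * of_bool (vertex_degree m ps v = k)"
      by (simp add: sum_distrib_right[symmetric] sum.distrib vertex_degree_def)
    finally show ?thesis by (cases "vertex_degree m ps v = k") auto
  qed
  \<comment> \<open>Full blocks include the unborn individuals of the last vertex. They have no
    children, so each has weight at most \<open>c\<close>, and there are at most \<open>m\<close> of
    them.\<close>
  then have "(\<Sum>p<Suc n * m. f p) = (k + m * c) * degree_count m k ps"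
    using sum.nat_group[of f m "Suc n"]
    by (simp add: degree_count_def n_def L_def sum_distrib_left lessThan_Suc_atMost mult.commute)
  moreover have "(\<Sum>p<Suc n * m. f p) = (\<Sum>p\<le>L. f p) + (\<Sum>p\<in>{Suc L..<Suc n * m}. f p)"
  proof -
    have "{..L} \<union> {Suc L..<Suc n * m} = {..<Suc n * m}" using L by auto
    moreover have "sum f ({..L} \<union> {Suc L..<Suc n * m}) = sum f {..L} + sum f {Suc L..<Suc n * m}"
      by (rule sum.union_disjoint) auto
    ultimately show ?thesis by metis
  qed
  moreover have "0 \<le> (\<Sum>p\<in>{Suc L..<Suc n * m}. f p)"
    using c by (intro sum_nonneg) (simp add: f_def)
  moreover have "(\<Sum>p\<in>{Suc L..<Suc n * m}. f p) \<le> m * c"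
  proof -
    have "(\<Sum>p\<in>{Suc L..<Suc n * m}. f p) \<le> real (card {Suc L..<Suc n * m}) * c"
    proof (rule sum_bounded_above)
      fix p assume "p \<in> {Suc L..<Suc n * m}"
      then have "count_list ps p = 0" using count_list_new[OF ps, of p] by (simp add: L_def)
      then show "f p \<le> c" using c by (simp add: f_def)
    qed
    also have "\<dots> \<le> m * c"
    proof (intro mult_right_mono c)
      have "n * m \<le> L" by (simp add: n_def)
      then show "real (card {Suc L..<Suc n * m}) \<le> m" by simp
    qed
    finally show ?thesis .
  qed
  ultimately show ?thesis unfolding f_def L_def by linarith
qed

text \<open>
  By the arithmetic-geometric mean inequality, the restoring term \<open>- \<alpha> * u\<close> absorbs the cross
  terms \<open>2 * u * (\<beta> * y + e)\<close>, so the increase of the second moment is bounded independently of \<open>u\<close>.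
\<close>

lemma second_moment_step:
  fixes w D :: "'a \<Rightarrow> real" and u y e \<alpha> \<beta> B T :: real
  assumes P: "finite P" and w: "\<And>p. p \<in> P \<Longrightarrow> 0 \<le> w p" and T: "sum w P = T" "0 < T"
    and D: "\<And>p. p \<in> P \<Longrightarrow> \<bar>D p\<bar> \<le> B" and \<alpha>: "0 < \<alpha>"
    and drift: "(\<Sum>p\<in>P. w p * D p) = \<beta> * y - \<alpha> * u + e"
  shows "(\<Sum>p\<in>P. (w p / T) * (u + D p)\<^sup>2) \<le> u\<^sup>2 + (\<beta>\<^sup>2 * y\<^sup>2 + e\<^sup>2) / (\<alpha> * T) + B\<^sup>2"
proof -
  have "(\<Sum>p\<in>P. w p * (u + D p)\<^sup>2) = T * u\<^sup>2 + 2 * u * (\<Sum>p\<in>P. w p * D p) + (\<Sum>p\<in>P. w p * (D p)\<^sup>2)"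
    unfolding T(1)[symmetric]
    by (simp add: power2_sum distrib_left sum.distrib sum_distrib_left sum_distrib_right mult_ac)
  also have "(\<Sum>p\<in>P. w p * (D p)\<^sup>2) \<le> (\<Sum>p\<in>P. w p * B\<^sup>2)"
    using order_trans[OF D abs_ge_self] w by (intro sum_mono mult_left_mono) (auto simp: abs_le_square_iff[symmetric])
  also have "(\<Sum>p\<in>P. w p * B\<^sup>2) = T * B\<^sup>2"
    by (simp add: sum_distrib_right[symmetric] T)
  also have "2 * u * (\<Sum>p\<in>P. w p * D p) \<le> (\<beta>\<^sup>2 * y\<^sup>2 + e\<^sup>2) / \<alpha>"
  proof -
    define x where "x = \<beta> * y + e"
    have "2 * u * (x - \<alpha> * u) * \<alpha> = x\<^sup>2 / 2 - 2 * (\<alpha> * u - x / 2)\<^sup>2"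
      by (simp add: power2_eq_square algebra_simps)
    also have "\<dots> \<le> x\<^sup>2 / 2" by simp
    also have "x\<^sup>2 / 2 = \<beta>\<^sup>2 * y\<^sup>2 + e\<^sup>2 - (\<beta> * y - e)\<^sup>2 / 2"
      by (simp add: x_def power2_eq_square algebra_simps add_divide_distrib diff_divide_distrib)
    also have "\<dots> \<le> \<beta>\<^sup>2 * y\<^sup>2 + e\<^sup>2" by simp
    finally have "2 * u * (x - \<alpha> * u) \<le> (\<beta>\<^sup>2 * y\<^sup>2 + e\<^sup>2) / \<alpha>"
      using \<alpha> by (simp only: pos_le_divide_eq)
    moreover have "(\<Sum>p\<in>P. w p * D p) = x - \<alpha> * u" by (simp add: drift x_def)
    ultimately show ?thesis by simp
  qed
  finally have "(\<Sum>p\<in>P. w p * (u + D p)\<^sup>2) / T \<le> (T * u\<^sup>2 + (\<beta>\<^sup>2 * y\<^sup>2 + e\<^sup>2) / \<alpha> + T * B\<^sup>2) / T"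
    using T(2) by (simp add: divide_right_mono)
  also have "\<dots> = u\<^sup>2 + (\<beta>\<^sup>2 * y\<^sup>2 + e\<^sup>2) / (\<alpha> * T) + B\<^sup>2"
    using T(2) by (simp add: add_divide_distrib)
  finally show ?thesis by (simp add: sum_divide_distrib)
qed

text \<open>The two equations balance inflow and outflow of the counts. For degree 0 the inflow is
  one new vertex per \<open>m\<close> births, which gives
  \<open>(1 + c) * (1 - q 0) = m * c * q 0\<close>.\<close>

locale degree_recursion =
  fixes m :: nat and c :: real and q :: "nat \<Rightarrow> real"
  assumes m: "0 < m" and c: "0 < c"
    and q_0: "q 0 * (1 + c + m * c) = 1 + c"
    and q_Suc: "\<And>k. q (Suc k) * (1 + c + Suc k + m * c) = (k + m * c) * q k"
begin

definition mean :: "nat \<Rightarrow> (nat list \<Rightarrow> real) \<Rightarrow> real" where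
  "mean L f = (\<Sum>ps\<in>histories L. history_prob (\<lambda>k. k + c) ps * f ps)"

definition total :: "nat list \<Rightarrow> real" where
  "total ps = length ps + (real (length ps) + 1) * c"

text \<open>
  The term for \<open>k = 0\<close> removes the periodic fluctuation that comes from a new vertex appearing
  only once in \<open>m\<close> steps.
\<close>

definition dev :: "nat \<Rightarrow> nat list \<Rightarrow> real" where
  "dev k ps = degree_count m k ps - q k * (real (length ps) + 1) / m -
     of_bool (k = 0) * (real (length ps div m) + 1 - (real (length ps) + 1) / m)"

definition incr :: "nat \<Rightarrow> nat list \<Rightarrow> nat \<Rightarrow> real" where
  "incr k ps p = of_bool (Suc (vertex_degree m ps (p div m)) = k) - of_bool (vertex_degree m ps (p div m) = k)
     - q k / m + of_bool (k = 0) / m"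

lemma rate_pos: "0 < real k + c"
  using c by simp

text \<open>A new vertex raises \<open>degree_count m 0\<close> and the rounding term by the same
  indicator; what remains of the two is the smooth rate \<open>1 / m\<close>.\<close>

lemma dev_Cons:
  assumes "parent_list (p # ps)"
  shows "dev k (p # ps) = dev k ps + incr k ps p"
proof -
  have "real (Suc (length ps) div m) = real (length ps div m) + of_bool (m dvd Suc (length ps))"
    by (simp add: div_Suc mod_eq_0_iff_dvd)
  then show ?thesis
    unfolding dev_def incr_def degree_count_Cons[OF m assms]
    by (cases "k = 0") (simp_all add: add_divide_distrib algebra_simps)
qed

lemma abs_incr: "\<bar>incr k ps p\<bar> \<le> 2 + \<bar>q k\<bar>"
proof -
  have "\<bar>q k / m\<bar> \<le> \<bar>q k\<bar>" "0 \<le> of_bool (k = 0) / real m" "of_bool (k = 0) / real m \<le> 1"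
    using m by (auto simp: divide_le_eq mult_le_cancel_left1)
  moreover have "0 \<le> (of_bool P :: real)" "(of_bool P :: real) \<le> 1" for P by auto
  note this[of "Suc (vertex_degree m ps (p div m)) = k"] this[of "vertex_degree m ps (p div m) = k"]
  ultimately show ?thesis
    unfolding incr_def by linarith
qed

lemma round_bound: "\<bar>real (L div m) + 1 - (real L + 1) / m\<bar> \<le> 1"
proof -
  have L: "real L = real m * real (L div m) + real (L mod m)"
    by (metis mult_div_mod_eq of_nat_add of_nat_mult)
  have le: "real (L mod m) + 1 \<le> m"
    using m of_nat_mono[of "Suc (L mod m)" m, where 'a = real] by (simp add: Suc_le_eq)
  have "(real L + 1) / m = real (L div m) + (real (L mod m) + 1) / m"
    unfolding L using m by (simp add: add_divide_distrib)
  moreover have "(real (L mod m) + 1) / m \<le> 1" "0 \<le> (real (L mod m) + 1) / m"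
    using m le by (simp_all add: divide_le_eq)
  ultimately show ?thesis by linarith
qed

text \<open>After writing each count as its target plus \<open>dev\<close>, the terms proportional
  to the length cancel by the recursion for \<open>q\<close>. What is left is bounded: the
  incomplete vertex and the rounding error cost at most \<open>m * c\<close> in each of at most
  three terms, and the \<open>- 1\<close> in the total rate accounts for the rest.\<close>

lemma drift:
  assumes ps: "parent_list ps"
  shows "\<bar>(\<Sum>p\<le>length ps. (count_list ps p + c) * incr k ps p) -
     (case k of 0 \<Rightarrow> 0 | Suc l \<Rightarrow> (l + m * c) * dev l ps) + (k + m * c) * dev k ps\<bar>
    \<le> (k + 3 * (m * c)) + 1 + \<bar>q k\<bar>"
proof -
  define L where "L = real (length ps)"
  define r where "r = real (length ps div m) + 1 - (L + 1) / m"
  define S where "S k = (\<Sum>p\<le>length ps. (count_list ps p + c) * of_bool (vertex_degree m ps (p div m) = k))" for k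
  define d where "d k = (k + m * c) * degree_count m k ps - S k" for k
  have r: "\<bar>r\<bar> \<le> 1" using round_bound[of "length ps"] by (simp add: r_def L_def)
  have d: "\<bar>d k\<bar> \<le> m * c" for k
    using degree_weight[OF m _ ps, of c k] c by (simp add: d_def S_def abs_minus_commute)
  define Q where "Q k = q k / m" for k
  have S: "S k = (k + m * c) * (dev k ps + Q k * (L + 1) + of_bool (k = 0) * r) - d k" for k
    by (simp add: d_def dev_def L_def r_def Q_def)
  have T: "(\<Sum>p\<le>length ps. count_list ps p + c) = (L + 1) * (1 + c) - 1"
    using sum_weights[OF ps, of c] by (simp add: L_def algebra_simps)
  have "(\<Sum>p\<le>length ps. (count_list ps p + c) * incr k ps p) =
      (\<Sum>p\<le>length ps. (count_list ps p + c) * of_bool (Suc (vertex_degree m ps (p div m)) = k)) - S k +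
      (\<Sum>p\<le>length ps. count_list ps p + c) * ((of_bool (k = 0) - q k) / m)"
  proof -
    have "(count_list ps p + c) * incr k ps p =
        (count_list ps p + c) * of_bool (Suc (vertex_degree m ps (p div m)) = k) -
        (count_list ps p + c) * of_bool (vertex_degree m ps (p div m) = k) +
        (count_list ps p + c) * ((of_bool (k = 0) - q k) / m)" for p
      by (simp add: incr_def diff_divide_distrib algebra_simps)
    then have "(\<Sum>p\<le>length ps. (count_list ps p + c) * incr k ps p) =
        (\<Sum>p\<le>length ps. (count_list ps p + c) * of_bool (Suc (vertex_degree m ps (p div m)) = k) -
        (count_list ps p + c) * of_bool (vertex_degree m ps (p div m) = k) +
        (count_list ps p + c) * ((of_bool (k = 0) - q k) / m))" by simp
    then show ?thesis
      unfolding S_def by (subst (asm) sum.distrib) (simp only: sum_subtractf sum_distrib_right)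
  qed
  also have "(\<Sum>p\<le>length ps. (count_list ps p + c) * of_bool (Suc (vertex_degree m ps (p div m)) = k)) =
      (case k of 0 \<Rightarrow> 0 | Suc l \<Rightarrow> S l)"
    by (cases k) (auto simp: S_def)
  finally have sum: "(\<Sum>p\<le>length ps. (count_list ps p + c) * incr k ps p) =
      (case k of 0 \<Rightarrow> 0 | Suc l \<Rightarrow> S l) - S k + ((L + 1) * (1 + c) - 1) * (of_bool (k = 0) / m - Q k)"
    by (simp only: T Q_def diff_divide_distrib)
  have qm: "\<bar>Q k\<bar> \<le> \<bar>q k\<bar>" "1 / real m \<le> 1" "0 \<le> 1 / real m"
    using m by (auto simp: Q_def divide_le_eq mult_le_cancel_left1)
  show ?thesis
  proof (cases k)
    case 0
    have "(1 - q 0) * (1 + c) = m * c * q 0" using q_0 by (simp add: algebra_simps)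
    then have "(1 - q 0) * (1 + c) / m = m * c * q 0 / m" by (simp only:)
    then have "m * c * Q 0 = (1 / m - Q 0) * (1 + c)"
      by (simp only: Q_def diff_divide_distrib[symmetric] times_divide_eq_left times_divide_eq_right)
    then have cancel: "((L + 1) * (1 + c) - 1) * (1 / m - Q 0) = (L + 1) * (m * c * Q 0) - (1 / m - Q 0)"
      by (simp only:) (simp only: algebra_simps)
    have S0: "S 0 = m * c * dev 0 ps + (L + 1) * (m * c * Q 0) + m * c * r - d 0"
      unfolding S by (simp add: algebra_simps)
    have "(\<Sum>p\<le>length ps. (count_list ps p + c) * incr k ps p) + m * c * dev 0 ps =
        - (m * c * r) + d 0 - (1 / m - Q 0)"
      using sum 0 S0 cancel by simp
    moreover have "\<bar>m * c * r\<bar> \<le> m * c"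
      using r c by (simp add: abs_mult mult_left_le)
    ultimately show ?thesis
      using d[of 0] qm 0 by (simp only: nat.case of_nat_0 add_0_left diff_0_right)
  next
    case (Suc l)
    have "(l + m * c) * q l - (k + m * c) * q k = (1 + c) * q k"
      using q_Suc[of l] Suc by (simp add: algebra_simps)
    then have "((l + m * c) * q l - (k + m * c) * q k) / m = (1 + c) * q k / m" by (simp only:)
    then have "(l + m * c) * Q l - (k + m * c) * Q k = (1 + c) * Q k"
      by (simp only: Q_def diff_divide_distrib times_divide_eq_right)
    then have cancel: "(L + 1) * ((l + m * c) * Q l) - (L + 1) * ((k + m * c) * Q k) = (L + 1) * (1 + c) * Q k"
      by (metis mult.assoc right_diff_distrib)
    have Sk: "S k = (k + m * c) * dev k ps + (L + 1) * ((k + m * c) * Q k) - d k"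
      unfolding S using Suc by (simp add: algebra_simps)
    have Sl: "S l = (l + m * c) * dev l ps + (L + 1) * ((l + m * c) * Q l) +
        (l + m * c) * (of_bool (l = 0) * r) - d l"
      unfolding S by (simp only: algebra_simps)
    have T': "((L + 1) * (1 + c) - 1) * (of_bool (k = 0) / m - Q k) = Q k - (L + 1) * (1 + c) * Q k"
      using Suc by (simp add: algebra_simps)
    have "(\<Sum>p\<le>length ps. (count_list ps p + c) * incr k ps p) - (l + m * c) * dev l ps + (k + m * c) * dev k ps =
        (l + m * c) * (of_bool (l = 0) * r) - d l + d k + Q k"
      using sum[unfolded T'] Suc Sk Sl cancel by (simp only: nat.case)
    \<comment> \<open>Only \<open>l = 0\<close> survives the indicator, and then the factor is just
      \<open>m * c\<close>.\<close>
    moreover have "\<bar>(l + m * c) * (of_bool (l = 0) * r)\<bar> \<le> m * c"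
      using r c by (auto simp: abs_mult mult_left_le)
    moreover have "0 \<le> real k" by simp
    ultimately show ?thesis
      using d[of l] d[of k] qm Suc by (simp only: nat.case)
  qed
qed

text \<open>The tower property for the last birth; the denominators are \<open>total ps\<close> by
  \<open>sum_weights\<close>.\<close>

lemma mean_Suc: "mean (Suc L) f = mean L (\<lambda>ps. \<Sum>p\<le>L. (count_list ps p + c) / total ps * f (p # ps))"
proof -
  have "(\<Sum>p\<le>L. history_prob (\<lambda>k. k + c) (p # ps) * f (p # ps)) =
      history_prob (\<lambda>k. k + c) ps * (\<Sum>p\<le>L. (count_list ps p + c) / total ps * f (p # ps))"
    if "ps \<in> histories L" for ps
    using that sum_weights[of ps c] by (simp add: histories_def total_def sum_distrib_left mult_ac)
  then show ?thesis
    unfolding mean_def sum_histories_Suc by (intro sum.cong refl) blast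
qed

lemma mean_mono: "(\<And>ps. ps \<in> histories L \<Longrightarrow> f ps \<le> g ps) \<Longrightarrow> mean L f \<le> mean L g"
  unfolding mean_def
  by (intro sum_mono mult_left_mono history_prob_nonneg rate_pos) auto

lemma mean_add: "mean L (\<lambda>ps. f ps + g ps) = mean L f + mean L g"
  by (simp add: mean_def distrib_left sum.distrib)

lemma mean_cmult: "mean L (\<lambda>ps. a * f ps) = a * mean L f"
  by (simp add: mean_def sum_distrib_left mult_ac)

lemma mean_const: "mean L (\<lambda>_. a) = a"
  unfolding mean_def using sum_history_prob[OF rate_pos] by (simp add: sum_distrib_right[symmetric])

text \<open>The input \<open>y\<close> of the recursion is \<open>dev\<close> one degree lower, with
  factor \<open>k + m * c\<close> in the step to \<open>Suc k\<close>, and zero at the bottom. The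
  restoring rate \<open>\<alpha>\<close> is positive even for degree 0, thanks to
  \<open>m * c\<close>.\<close>

lemma dev_second_moment: "\<exists>C\<ge>0. \<forall>L. mean L (\<lambda>ps. (dev k ps)\<^sup>2) \<le> C * (real L + 1)"
proof -
  have step: "\<exists>C\<ge>0. \<forall>L. mean L (\<lambda>ps. (dev k ps)\<^sup>2) \<le> C * (real L + 1)"
    if K: "0 \<le> K" "\<And>L. mean L (\<lambda>ps. (y ps)\<^sup>2) \<le> K * (real L + 1)"
      and y: "\<And>ps. (case k of 0 \<Rightarrow> 0 | Suc l \<Rightarrow> (l + m * c) * dev l ps) = \<beta> * y ps" for k \<beta> K and y :: "nat list \<Rightarrow> real"
  proof -
    define \<alpha> where "\<alpha> = k + m * c"
    define e where "e = (k + 3 * (m * c)) + 1 + \<bar>q k\<bar>"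
    define B where "B = 2 + \<bar>q k\<bar>"
    define C where "C = (\<beta>\<^sup>2 * K + e\<^sup>2) / (\<alpha> * c) + B\<^sup>2"
    have \<alpha>: "0 < \<alpha>" using m c by (simp add: \<alpha>_def add_nonneg_pos)
    have rec: "mean (Suc L) (\<lambda>ps. (dev k ps)\<^sup>2) \<le> mean L (\<lambda>ps. (dev k ps)\<^sup>2) + C" for L
    proof -
      define A where "A = 1 / (\<alpha> * (c * (real L + 1)))"
      have A: "0 \<le> A" using \<alpha> c by (simp add: A_def)
      have "mean (Suc L) (\<lambda>ps. (dev k ps)\<^sup>2) \<le>
          mean L (\<lambda>ps. (dev k ps)\<^sup>2 + (A * \<beta>\<^sup>2 * (y ps)\<^sup>2 + (A * e\<^sup>2 + B\<^sup>2)))"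
        unfolding mean_Suc
      proof (rule mean_mono)
        fix ps assume "ps \<in> histories L"
        then have ps: "parent_list ps" and L: "length ps = L" by (auto simp: histories_def)
        define e' where "e' = (\<Sum>p\<le>L. (count_list ps p + c) * incr k ps p) - \<beta> * y ps + \<alpha> * dev k ps"
        have e': "e'\<^sup>2 \<le> e\<^sup>2"
          using drift[OF ps, of k] y[of ps] L by (intro power2_le_iff_abs_le[THEN iffD2]) (auto simp: e_def e'_def \<alpha>_def)
        have T: "c * (real L + 1) \<le> total ps" using L by (simp add: total_def mult.commute)
        have T0: "0 < c * (real L + 1)" using c by simp
        then have "0 < total ps" using T by linarith
        have "(\<Sum>p\<le>L. (count_list ps p + c) / total ps * (dev k (p # ps))\<^sup>2) =
            (\<Sum>p\<le>L. (count_list ps p + c) / total ps * (dev k ps + incr k ps p)\<^sup>2)"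
          using ps L by (intro sum.cong) (auto simp: dev_Cons)
        also have "\<dots> \<le> (dev k ps)\<^sup>2 + (\<beta>\<^sup>2 * (y ps)\<^sup>2 + e'\<^sup>2) / (\<alpha> * total ps) + B\<^sup>2"
        proof (rule second_moment_step)
          show "(\<Sum>p\<le>L. count_list ps p + c) = total ps"
            using sum_weights[OF ps, of c] L by (simp add: total_def)
        qed (use c \<open>0 < total ps\<close> \<alpha> abs_incr in \<open>auto simp: B_def e'_def\<close>)
        also have "(\<beta>\<^sup>2 * (y ps)\<^sup>2 + e'\<^sup>2) / (\<alpha> * total ps) \<le> (\<beta>\<^sup>2 * (y ps)\<^sup>2 + e\<^sup>2) / (\<alpha> * (c * (real L + 1)))"
          using T T0 \<alpha> e' by (intro frac_le mult_left_mono) auto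
        also have "\<dots> = A * \<beta>\<^sup>2 * (y ps)\<^sup>2 + A * e\<^sup>2" by (simp add: A_def add_divide_distrib)
        finally show "(\<Sum>p\<le>L. (count_list ps p + c) / total ps * (dev k (p # ps))\<^sup>2) \<le>
            (dev k ps)\<^sup>2 + (A * \<beta>\<^sup>2 * (y ps)\<^sup>2 + (A * e\<^sup>2 + B\<^sup>2))" by simp
      qed
      also have "\<dots> = mean L (\<lambda>ps. (dev k ps)\<^sup>2) + (A * \<beta>\<^sup>2 * mean L (\<lambda>ps. (y ps)\<^sup>2) + (A * e\<^sup>2 + B\<^sup>2))"
        by (simp add: mean_add mean_cmult mean_const)
      also have "A * \<beta>\<^sup>2 * mean L (\<lambda>ps. (y ps)\<^sup>2) \<le> A * \<beta>\<^sup>2 * (K * (real L + 1))"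
        using K(2)[of L] A by (intro mult_left_mono) auto
      \<comment> \<open>The second moment of \<open>y\<close> grows linearly, but so does the total
        rate in the denominator; the increase per birth therefore stays bounded.\<close>
      also have "\<dots> = \<beta>\<^sup>2 * K / (\<alpha> * c)"
      proof -
        define z where "z = real L + 1"
        have "0 < z" by (simp add: z_def)
        then show ?thesis unfolding A_def z_def[symmetric] using \<alpha> c by (simp add: field_simps)
      qed
      also have "A * e\<^sup>2 \<le> 1 / (\<alpha> * c) * e\<^sup>2"
        unfolding A_def using \<alpha> c by (intro mult_right_mono frac_le) (auto simp: algebra_simps)
      finally show ?thesis by (simp add: C_def add_divide_distrib)
    qed
    have C: "0 \<le> C" using K(1) \<alpha> c by (auto simp: C_def intro!: add_nonneg_nonneg divide_nonneg_nonneg)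
    \<comment> \<open>The extra square covers the empty history, where the induction starts.\<close>
    define C' where "C' = C + (dev k [])\<^sup>2"
    have "mean L (\<lambda>ps. (dev k ps)\<^sup>2) \<le> C' * (real L + 1)" for L
    proof (induction L)
      case 0
      then show ?case using C by (simp add: mean_def C'_def)
    next
      case (Suc L)
      have "C \<le> C'" by (simp add: C'_def)
      then show ?case using rec[of L] Suc by (simp add: algebra_simps)
    qed
    then show ?thesis using C by (intro exI[of _ C']) (simp add: C'_def)
  qed
  show ?thesis
  proof (induction k)
    case 0
    show ?case by (rule step[of 0 "\<lambda>_. 0" 0 0]) (simp_all add: mean_const)
  next
    case (Suc k)
    then obtain C where "0 \<le> C" "\<And>L. mean L (\<lambda>ps. (dev k ps)\<^sup>2) \<le> C * (real L + 1)" by blast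
    then show ?case by (rule step[of C "dev k" "Suc k" "k + m * c"]) simp
  qed
qed

text \<open>Replacing the smooth target by the actual number of vertices changes the deviation by a
  bounded amount, which costs a factor 2 and a constant in the second moment.\<close>

lemma degree_count_second_moment:
  "\<exists>C. \<forall>L. mean L (\<lambda>ps. (degree_count m k ps - q k * (real (L div m) + 1))\<^sup>2) \<le> C * (real L + 1)"
proof -
  obtain C where C: "\<And>L. mean L (\<lambda>ps. (dev k ps)\<^sup>2) \<le> C * (real L + 1)"
    using dev_second_moment by blast
  define b where "b = 1 + \<bar>q k\<bar>"
  have "mean L (\<lambda>ps. (degree_count m k ps - q k * (real (L div m) + 1))\<^sup>2) \<le> (2 * C + 2 * b\<^sup>2) * (real L + 1)" for L
  proof -
    have "mean L (\<lambda>ps. (degree_count m k ps - q k * (real (L div m) + 1))\<^sup>2) \<le>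
        mean L (\<lambda>ps. 2 * (dev k ps)\<^sup>2 + 2 * b\<^sup>2)"
    proof (rule mean_mono)
      fix ps assume "ps \<in> histories L"
      then have L: "length ps = L" by (simp add: histories_def)
      define r where "r = real (L div m) + 1 - (real L + 1) / m"
      define s where "s = (of_bool (k = 0) - q k) * r"
      have "\<bar>s\<bar> \<le> b * 1"
        unfolding s_def abs_mult b_def using round_bound[of L] by (intro mult_mono) (auto simp: r_def)
      then have s: "s\<^sup>2 \<le> b\<^sup>2" by (intro power2_le_iff_abs_le[THEN iffD2]) (auto simp: b_def)
      have "degree_count m k ps - q k * (real (L div m) + 1) = dev k ps + s"
        by (cases "k = 0") (simp_all add: dev_def s_def r_def L algebra_simps diff_divide_distrib add_divide_distrib)
      moreover have "(dev k ps + s)\<^sup>2 = 2 * (dev k ps)\<^sup>2 + 2 * s\<^sup>2 - (dev k ps - s)\<^sup>2"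
        by (simp add: power2_eq_square algebra_simps)
      moreover have "0 \<le> (dev k ps - s)\<^sup>2" by simp
      ultimately show "(degree_count m k ps - q k * (real (L div m) + 1))\<^sup>2 \<le> 2 * (dev k ps)\<^sup>2 + 2 * b\<^sup>2"
        using s by (simp only:)
    qed
    also have "\<dots> = 2 * mean L (\<lambda>ps. (dev k ps)\<^sup>2) + 2 * b\<^sup>2"
      by (simp add: mean_add mean_cmult mean_const)
    also have "\<dots> \<le> 2 * (C * (real L + 1)) + 2 * b\<^sup>2 * (real L + 1)"
      using C[of L] by (intro add_mono mult_left_mono) (auto simp: mult_le_cancel_left1)
    finally show ?thesis by (simp add: algebra_simps)
  qed
  then show ?thesis by blast
qed

end

section \<open>Law of the history\<close>

lemma exp_clocks_cong:
  fixes r :: "'i \<Rightarrow> real"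
  assumes "\<And>i \<omega>. i \<in> J \<Longrightarrow> X i \<omega> = Y i \<omega>" "exp_clocks M A r J X"
  shows "exp_clocks M A r J Y"
proof -
  have eq: "Y i = X i" if "i \<in> J" for i using assms(1) that by auto
  show ?thesis
    unfolding exp_clocks_def
  proof (intro conjI ballI allI impI)
    fix i assume "i \<in> J"
    then show "Y i \<in> borel_measurable M" using assms(2) by (simp add: eq exp_clocks_def)
  next
    fix K and t :: "'i \<Rightarrow> real" assume K: "finite K" "K \<subseteq> J"
    have "{\<omega>\<in>A. \<forall>i\<in>K. t i < Y i \<omega>} = {\<omega>\<in>A. \<forall>i\<in>K. t i < X i \<omega>}"
      using K eq by (auto simp: subset_iff)
    then show "measure M {\<omega>\<in>A. \<forall>i\<in>K. t i < Y i \<omega>} = measure M A * (\<Prod>i\<in>K. exp (- r i * max 0 (t i)))"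
      using exp_clocksD[OF assms(2) K, of t] by simp
  qed
qed

lemma birth_clocks_measurable:
  assumes "birth_clocks M r E"
  shows "E x k \<in> borel_measurable M"
  using assms distributed_measurable[of M lborel "E x k"] by (auto simp: birth_clocks_def)

lemma birth_clocks_exp_clocks:
  assumes clocks: "birth_clocks M r E" and r: "\<And>k. 0 < r k"
  shows "exp_clocks M (space M) (\<lambda>(x, k). r k) UNIV (\<lambda>(x, k). E x k)"
proof -
  interpret prob_space M using clocks by (simp add: birth_clocks_def)
  have indep: "indep_vars (\<lambda>_. borel) (\<lambda>(x, k). E x k) UNIV"
    and dist: "\<And>x k. distributed M lborel (E x k) (exponential_density (r k))"
    using clocks by (auto simp: birth_clocks_def)
  have single: "prob (E x k -` {t<..} \<inter> space M) = exp (- r k * max 0 t)" for x k t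
  proof -
    have "emeasure M (E x k -` {t<..} \<inter> space M) = emeasure (distr M lborel (E x k)) {t<..}"
      using birth_clocks_measurable[OF clocks] by (subst emeasure_distr) auto
    also have "\<dots> = ennreal (exp (- r k * max 0 t))"
      using dist[of x k] by (simp add: distributed_distr_eq_density exponential_tail r)
    finally show ?thesis by (simp add: measure_def)
  qed
  show ?thesis
    unfolding exp_clocks_def
  proof (intro conjI ballI allI impI)
    fix K :: "(nat list \<times> nat) set" and t :: "nat list \<times> nat \<Rightarrow> real" assume K: "finite K"
    show "prob {\<omega>\<in>space M. \<forall>i\<in>K. t i < (case i of (x, k) \<Rightarrow> E x k) \<omega>} =
        prob (space M) * (\<Prod>i\<in>K. exp (- (case i of (x, k) \<Rightarrow> r k) * max 0 (t i)))"
    proof (cases "K = {}")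
      case False
      have "{\<omega>\<in>space M. \<forall>i\<in>K. t i < (case i of (x, k) \<Rightarrow> E x k) \<omega>} =
          (\<Inter>i\<in>K. (case i of (x, k) \<Rightarrow> E x k) -` {t i<..} \<inter> space M)"
        using False by auto
      also have "prob \<dots> = (\<Prod>i\<in>K. prob ((case i of (x, k) \<Rightarrow> E x k) -` {t i<..} \<inter> space M))"
        using indep_varsD[OF indep False K, of "\<lambda>i. {t i<..}"] by simp
      finally show ?thesis
        by (simp add: prob_space single case_prod_unfold)
    qed simp
  qed (auto intro: birth_clocks_measurable[OF clocks])
qed

lemma birth_time_measurable:
  assumes "birth_clocks M r E"
  shows "(\<lambda>\<omega>. birth_time (\<lambda>x k. E x k \<omega>) x) \<in> borel_measurable M"
  by (induction x) (auto simp: jump_time_def intro!: borel_measurable_add borel_measurable_sum birth_clocks_measurable[OF assms])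

text \<open>
  Clocks at the time of birth of the individual \<open>length ps\<close>: for an individual already born, the
  remaining time until its next child; all later holding times are unchanged.
\<close>

definition residual :: "(nat list \<Rightarrow> nat \<Rightarrow> 'w \<Rightarrow> real) \<Rightarrow> nat list \<Rightarrow> nat list \<times> nat \<Rightarrow> 'w \<Rightarrow> real" where
  "residual E ps = (\<lambda>(x, k) \<omega>. if (x, k) \<in> (\<lambda>i. (node ps i, count_list ps i)) ` {..length ps}
     then birth_time (\<lambda>x k. E x k \<omega>) (k # x) - birth_time (\<lambda>x k. E x k \<omega>) (node ps (length ps))
     else E x k \<omega>)"

text \<open>This is the update performed by a race: running clocks lose the winner's residual. The
  clocks that start now, namely the first one of the newborn and the following one of
  \<open>p\<close>, have their full holding time left, which is the value they had before.\<close>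

lemma residual_Cons:
  assumes ps: "parent_list (p # ps)" and fresh: "k # x \<notin> nodes (p # ps)"
  defines "C \<equiv> (\<lambda>i. (node ps i, count_list ps i)) ` {..length ps}"
  shows "residual E (p # ps) (x, k) \<omega> =
    (if (x, k) \<in> C then residual E ps (x, k) \<omega> - residual E ps (node ps p, count_list ps p) \<omega>
     else residual E ps (x, k) \<omega>)"
proof -
  define b where "b = birth_time (\<lambda>x k. E x k \<omega>)"
  define C' where "C' = (\<lambda>i. (node (p # ps) i, count_list (p # ps) i)) ` {..length (p # ps)}"
  have p: "p \<le> length ps" using ps by simp
  have new: "b (node (p # ps) (length (p # ps))) = b (next_child ps p)"
    by (simp add: next_child_def)
  have res: "residual E ps z \<omega> = (case z of (x, k) \<Rightarrow>
      if (x, k) \<in> C then b (k # x) - b (node ps (length ps)) else E x k \<omega>)" for z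
    by (simp add: residual_def C_def b_def split: prod.split)
  have res': "residual E (p # ps) (x, k) \<omega> =
      (if (x, k) \<in> C' then b (k # x) - b (next_child ps p) else E x k \<omega>)"
    unfolding residual_def C'_def[symmetric] by (simp add: b_def next_child_def)
  have a: "residual E ps (node ps p, count_list ps p) \<omega> = b (next_child ps p) - b (node ps (length ps))"
    using p by (auto simp: res C_def next_child_def)
  show ?thesis
  proof (cases "(x, k) \<in> C")
    case True
    then obtain i where i: "i \<le> length ps" "x = node ps i" "k = count_list ps i" by (auto simp: C_def)
    then have "i \<noteq> p" using fresh by (auto simp: nodes_Cons next_child_def)
    then have "(x, k) = (node (p # ps) i, count_list (p # ps) i)" "i \<le> length (p # ps)"
      using i by auto
    then have "(x, k) \<in> C'" unfolding C'_def by blast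
    then show ?thesis using True by (simp only: res' a) (simp add: res)
  next
    case notC: False
    show ?thesis
    proof (cases "(x, k) \<in> C'")
      case True
      then obtain i where i: "i \<le> Suc (length ps)" "x = node (p # ps) i" "k = count_list (p # ps) i"
        by (auto simp: C'_def simp del: node.simps count_list.simps)
      consider "i = Suc (length ps)" | "i = p" | "i \<le> length ps" "i \<noteq> p" using i(1) by force
      then have "b (k # x) - b (next_child ps p) = E x k \<omega>"
      proof cases
        case 1
        have "count_list (p # ps) i = 0" using 1 count_list_new[OF ps, of i] by simp
        then show ?thesis using i 1 by (simp add: b_def jump_time_def next_child_def)
      next
        case 2
        then show ?thesis using i p by (simp add: b_def jump_time_def next_child_def)
      next
        case 3
        then have "(x, k) \<in> C" using i by (auto simp: C_def)
        then show ?thesis using notC by simp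
      qed
      then show ?thesis using True notC by (simp only: res' if_True if_False) (simp add: res)
    qed (use notC in \<open>simp add: res res'\<close>)
  qed
qed

text \<open>The probability of a history and the law of the clocks after it are proved together,
  since the next race is run by these clocks. Each extension of the history is one outcome of that
  race.\<close>

lemma history_clocks:
  assumes clocks: "birth_clocks M r E" and r: "\<And>k. 0 < r k" and ps: "parent_list ps"
  shows "history_event (space M) E ps \<in> sets M \<and>
    measure M (history_event (space M) E ps) = history_prob r ps \<and>
    exp_clocks M (history_event (space M) E ps) (\<lambda>(x, k). r k) {(x, k). k # x \<notin> nodes ps} (residual E ps)"
  using ps
proof (induction ps)
  case Nil
  interpret prob_space M using clocks by (simp add: birth_clocks_def)
  have "exp_clocks M (space M) (\<lambda>(x, k). r k) {(x, k). k # x \<notin> nodes []} (residual E [])"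
    by (rule exp_clocks_cong[of _ "\<lambda>(x, k). E x k"])
      (use birth_clocks_exp_clocks[OF clocks r] in \<open>auto simp: residual_def jump_time_def\<close>)
  then show ?case by (simp add: prob_space)
next
  case (Cons p ps)
  then have p: "p \<le> length ps" and ps: "parent_list ps" by auto
  define A where "A = history_event (space M) E ps"
  \<comment> \<open>The running clocks, one for each individual born so far; all other clocks in
    \<open>J\<close> have not started.\<close>
  define C where "C = (\<lambda>i. (node ps i, count_list ps i)) ` {..length ps}"
  define J where "J = {(x, k). k # x \<notin> nodes ps}"
  define a where "a = (node ps p, count_list ps p)"
  define R where "R = (\<lambda>(x :: nat list, k). r k)"
  have A: "A \<in> sets M" "measure M A = history_prob r ps" "exp_clocks M A R J (residual E ps)"
    using Cons.IH ps by (auto simp: A_def J_def R_def)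
  have "prob_space M" using clocks by (simp add: birth_clocks_def)
  have C: "finite C" "C \<subseteq> J" "a \<in> C"
    using p child_in_nodes_iff[OF ps] by (auto simp: C_def J_def a_def)
  have R: "0 < R i" for i using r by (simp add: R_def split: prod.split)
  have inj: "inj_on (\<lambda>i. (node ps i, count_list ps i)) {..length ps}"
    by (auto simp: inj_on_def inj_node[OF ps])
  define B where "B = {\<omega>\<in>A. \<forall>i\<in>C - {a}. residual E ps a \<omega> < residual E ps i \<omega>}"
  have B: "B = history_event (space M) E (p # ps)"
  proof -
    have res: "residual E ps (node ps i, count_list ps i) \<omega> =
        birth_time (\<lambda>x k. E x k \<omega>) (next_child ps i) - birth_time (\<lambda>x k. E x k \<omega>) (node ps (length ps))"
      if "i \<le> length ps" for i \<omega>
      using that by (auto simp: residual_def next_child_def)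
    have Ca: "C - {a} = (\<lambda>i. (node ps i, count_list ps i)) ` ({..length ps} - {p})"
      using inj_on_image_set_diff[OF inj, of "{..length ps}" "{p}"] p by (simp add: C_def a_def)
    show ?thesis
      using p unfolding B_def Ca by (auto simp: a_def res A_def)
  qed
  note race = exp_clocks_race[OF \<open>prob_space M\<close> A(1,3) R C, folded B_def]
  have "sum R C = (\<Sum>i\<le>length ps. r (count_list ps i))"
    unfolding C_def by (subst sum.reindex[OF inj]) (simp add: R_def)
  then have "measure M B = history_prob r (p # ps)"
    using race(1) by (simp add: A R_def a_def)
  moreover have "J - {a} = {(x, k). k # x \<notin> nodes (p # ps)}"
    by (auto simp: J_def a_def nodes_Cons next_child_def)
  moreover have "exp_clocks M B R (J - {a}) (residual E (p # ps))"
  proof (rule exp_clocks_cong[OF _ race(2)])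
    fix i \<omega> assume "i \<in> J - {a}"
    then obtain x k where "i = (x, k)" "k # x \<notin> nodes (p # ps)"
      by (cases i) (auto simp: J_def a_def nodes_Cons next_child_def)
    then show "(if i \<in> C then residual E ps i \<omega> - residual E ps a \<omega> else residual E ps i \<omega>) =
        residual E (p # ps) i \<omega>"
      using residual_Cons[OF Cons.prems, of k x E \<omega>] by (simp add: C_def a_def)
  qed
  moreover have "B \<in> sets M"
  proof -
    note [measurable] = A(1) birth_time_measurable[OF clocks]
    show ?thesis
      unfolding B history_event.simps A_def[symmetric]
      using sets.sets_into_space[OF A(1)] by measurable
  qed
  ultimately show ?case by (simp only: B[symmetric] R_def[symmetric])
qed

text \<open>Two extensions of one history would need two strict winners of the same race.\<close>

lemma history_event_disjoint:
  assumes "ps \<in> histories L" "qs \<in> histories L" "ps \<noteq> qs"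
  shows "history_event S E ps \<inter> history_event S E qs = {}"
  using assms
proof (induction L arbitrary: ps qs)
  case (Suc L)
  then obtain p ps' q qs' where *: "ps = p # ps'" "qs = q # qs'" "ps' \<in> histories L" "qs' \<in> histories L"
    "p \<le> L" "q \<le> L"
    by (auto simp: histories_Suc)
  show ?case
  proof (cases "ps' = qs'")
    case True
    then have "p \<noteq> q" using Suc.prems * by auto
    then show ?thesis using * True by (fastforce simp: histories_def)
  next
    case False
    then show ?thesis using Suc.IH[of ps' qs'] * by auto
  qed
qed simp

text \<open>Disjoint events whose probabilities add up to one leave only a null set, so ties between
  candidates are disposed of without a separate argument.\<close>

lemma AE_history:
  assumes clocks: "birth_clocks M r E" and r: "\<And>k. 0 < r k"
  shows "AE \<omega> in M. \<exists>ps\<in>histories L. \<omega> \<in> history_event (space M) E ps"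
proof -
  interpret prob_space M using clocks by (simp add: birth_clocks_def)
  have hist: "history_event (space M) E ps \<in> sets M"
    "prob (history_event (space M) E ps) = history_prob r ps" if "ps \<in> histories L" for ps
    using history_clocks[OF clocks r, of ps] that by (auto simp: histories_def)
  have "prob (\<Union>ps\<in>histories L. history_event (space M) E ps) = (\<Sum>ps\<in>histories L. history_prob r ps)"
    using hist history_event_disjoint[of _ L _ "space M" E]
    by (subst finite_measure_finite_Union) (auto simp: disjoint_family_on_def)
  also have "\<dots> = 1" by (rule sum_history_prob[OF r])
  finally have "AE \<omega> in M. \<omega> \<in> (\<Union>ps\<in>histories L. history_event (space M) E ps)"
    by (intro AE_prob_1)
  then show ?thesis by simp
qed

lemma AE_birth_clocks_pos:
  assumes clocks: "birth_clocks M r E" and r: "\<And>k. 0 < r k"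
  shows "AE \<omega> in M. \<forall>x k. 0 < E x k \<omega>"
proof -
  interpret prob_space M using clocks by (simp add: birth_clocks_def)
  have "AE \<omega> in M. 0 < E x k \<omega>" for x k
  proof -
    have "prob {\<omega>\<in>space M. 0 < E x k \<omega>} = 1"
      using exp_clocksD[OF birth_clocks_exp_clocks[OF clocks r], of "{(x, k)}" "\<lambda>_. 0"]
      by (simp add: prob_space)
    then show ?thesis using AE_prob_1[of "{\<omega>\<in>space M. 0 < E x k \<omega>}"] by simp
  qed
  then show ?thesis by (simp add: AE_all_countable)
qed

section \<open>Convergence of the degree fractions\<close>

lemma measurable_card_countable:
  fixes P :: "'a \<Rightarrow> 'b :: countable \<Rightarrow> bool"
  assumes [measurable]: "\<And>y. Measurable.pred M (\<lambda>\<omega>. P \<omega> y)"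
  shows "(\<lambda>\<omega>. card {y. P \<omega> y}) \<in> measurable M (count_space UNIV)"
    and "Measurable.pred M (\<lambda>\<omega>. finite {y. P \<omega> y})"
proof -
  \<comment> \<open>Encoding by \<open>to_nat\<close> reduces to sets of natural numbers, where
    finiteness is boundedness and hence a countable condition.\<close>
  define N where "N \<omega> = {i. \<exists>y. i = to_nat y \<and> P \<omega> y}" for \<omega>
  have N: "N \<omega> = to_nat ` {y. P \<omega> y}" for \<omega> by (auto simp: N_def)
  have [measurable]: "Measurable.pred M (\<lambda>\<omega>. i \<in> N \<omega>)" for i
    unfolding N_def mem_Collect_eq by measurable
  have inj: "inj_on to_nat A" for A :: "'b set" by (simp add: inj_on_def)
  have "card {y. P \<omega> y} = card (N \<omega>)" for \<omega>
    unfolding N using inj by (simp add: card_image)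
  then show "(\<lambda>\<omega>. card {y. P \<omega> y}) \<in> measurable M (count_space UNIV)" by simp
  have "finite {y. P \<omega> y} \<longleftrightarrow> (\<exists>b. \<forall>i. i \<in> N \<omega> \<longrightarrow> i \<le> b)" for \<omega>
    using finite_image_iff[OF inj, of "{y. P \<omega> y}"] unfolding N[symmetric]
    by (simp add: finite_nat_set_iff_bounded_le Ball_def)
  then show "Measurable.pred M (\<lambda>\<omega>. finite {y. P \<omega> y})" by simp
qed

context
  fixes M :: "'w measure" and E :: "nat list \<Rightarrow> nat \<Rightarrow> 'w \<Rightarrow> real" and r :: "nat \<Rightarrow> real"
  assumes clocks: "birth_clocks M r E"
begin

lemma individual_measurable [measurable]:
  "(\<lambda>\<omega>. individual (\<lambda>x k. E x k \<omega>) n) \<in> measurable M (count_space UNIV)"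
  unfolding individual_def
proof (rule measurable_THE[where I = UNIV])
  fix x
  have [measurable]: "Measurable.pred M (\<lambda>\<omega>. born_before (\<lambda>x k. E x k \<omega>) y x)" for y
  proof -
    note [measurable] = birth_time_measurable[OF clocks]
    show ?thesis unfolding born_before_def by measurable
  qed
  note [measurable] = measurable_card_countable[where M = M and P = "\<lambda>\<omega> y. born_before (\<lambda>x k. E x k \<omega>) y x"]
  show "Measurable.pred M (\<lambda>\<omega>. finite {y. born_before (\<lambda>x k. E x k \<omega>) y x} \<and>
      Suc (card {y. born_before (\<lambda>x k. E x k \<omega>) y x}) = n)"
    by measurable
next
  fix \<omega> x y
  assume "finite {z. born_before (\<lambda>x k. E x k \<omega>) z x} \<and> Suc (card {z. born_before (\<lambda>x k. E x k \<omega>) z x}) = n"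
    "finite {z. born_before (\<lambda>x k. E x k \<omega>) z y} \<and> Suc (card {z. born_before (\<lambda>x k. E x k \<omega>) z y}) = n"
  then show "x = y" by (intro individual_unique[of "\<lambda>x k. E x k \<omega>"]) auto
qed auto

text \<open>Ancestry names form a countable type, so evaluating at a random name is a countable case
  distinction.\<close>

lemma tau_measurable [measurable]: "(\<lambda>\<omega>. tau (\<lambda>x k. E x k \<omega>) n) \<in> borel_measurable M"
  unfolding tau_def
  by (rule measurable_compose_countable[OF birth_time_measurable[OF clocks] individual_measurable])

lemma birth_count_measurable:
  assumes [measurable]: "\<And>i. (\<lambda>\<omega>. s i \<omega>) \<in> borel_measurable M" "t \<in> borel_measurable M"
  shows "(\<lambda>\<omega>. birth_count (\<lambda>i. s i \<omega>) (t \<omega>)) \<in> measurable M (count_space UNIV)"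
  unfolding birth_count_def atLeastLessThan_iff by measurable

lemma pa_degree_measurable [measurable]:
  "Measurable.pred M (\<lambda>\<omega>. pa_degree (\<lambda>x k. E x k \<omega>) m n j v = d)"
proof -
  note [measurable] = birth_clocks_measurable[OF clocks]
  have count [measurable]: "(\<lambda>\<omega>. birth_count (\<lambda>i. E (individual (\<lambda>x k. E x k \<omega>) a) i \<omega>)
      (tau (\<lambda>x k. E x k \<omega>) b - tau (\<lambda>x k. E x k \<omega>) a)) \<in> measurable M (count_space UNIV)" for a b
  proof (rule birth_count_measurable)
    show "(\<lambda>\<omega>. E (individual (\<lambda>x k. E x k \<omega>) a) i \<omega>) \<in> borel_measurable M" for i
      by (rule measurable_compose_countable[OF birth_clocks_measurable[OF clocks] individual_measurable])
  qed measurable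
  have "(\<lambda>\<omega>. real (pa_degree (\<lambda>x k. E x k \<omega>) m n j v)) \<in> borel_measurable M"
    unfolding pa_degree_def cbp_degree_def of_nat_sum by measurable
  then have "Measurable.pred M (\<lambda>\<omega>. real (pa_degree (\<lambda>x k. E x k \<omega>) m n j v) = real d)"
    by measurable
  then show ?thesis by simp
qed

lemma degree_fraction_measurable:
  "(\<lambda>\<omega>. degree_fraction (\<lambda>x k. E x k \<omega>) m n j d) \<in> borel_measurable M"
proof -
  have [measurable]: "Measurable.pred M (\<lambda>\<omega>. v \<in> verts (pa (\<lambda>x k. E x k \<omega>) m n j))" for v
    unfolding pa_def cbp_def pre_digraph.simps mem_Collect_eq by measurable
  show ?thesis unfolding degree_fraction_def by measurable
qed

end

section \<open>Reading the degree fraction off a history\<close>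

lemma idx_div: "j \<in> {1..m} \<Longrightarrow> (m * (n - 1) + (j - 1)) div m = n - 1" for m n j :: nat
proof -
  assume "j \<in> {1..m}"
  then have "j - 1 < m" by auto
  then show ?thesis by (metis add.right_neutral div_less div_mult_self4 gr_implies_not0)
qed

text \<open>The pathwise conditions that hold almost surely. A history of every length means that
  all numbers are assigned, in strictly increasing order of birth times.\<close>

locale realised_histories =
  fixes S :: "'w set" and E :: "nat list \<Rightarrow> nat \<Rightarrow> 'w \<Rightarrow> real" and \<omega> :: 'w
  assumes pos: "\<And>x k. 0 < E x k \<omega>"
    and realised: "\<And>L. \<exists>ps\<in>histories L. \<omega> \<in> history_event S E ps"
begin

abbreviation "e \<equiv> \<lambda>x k. E x k \<omega>"

lemma tau_history:
  assumes "ps \<in> histories L" "\<omega> \<in> history_event S E ps" "i \<le> L"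
  shows "tau e (Suc i) = birth_time e (node ps i)"
  using history_individual[of ps \<omega> S E i] assms pos by (auto simp: tau_def histories_def)

lemma tau_strict_mono: "a < b \<Longrightarrow> tau e (Suc a) < tau e (Suc b)"
proof -
  assume "a < b"
  obtain ps where ps: "ps \<in> histories b" "\<omega> \<in> history_event S E ps" using realised by blast
  then show ?thesis
    using history_order[of ps \<omega> S E] pos \<open>a < b\<close> tau_history[OF ps, of a] tau_history[OF ps, of b]
    by (auto simp: histories_def)
qed

lemma tau_le_iff: "tau e (Suc a) \<le> tau e (Suc b) \<longleftrightarrow> a \<le> b"
  using tau_strict_mono[of a b] tau_strict_mono[of b a] by (cases a b rule: linorder_cases) auto

text \<open>Individual \<open>(n, j)\<close> has number \<open>m * (n - 1) + (j - 1)\<close> when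
  counting from 0, so the history of this length describes everything born up to its birth time. The
  vertices present are then those up to \<open>n\<close>.\<close>

lemma degree_fraction_history:
  assumes ps: "ps \<in> histories (m * (n - 1) + (j - 1))" "\<omega> \<in> history_event S E ps"
    and n: "1 \<le> n" and j: "j \<in> {1..m}"
  shows "degree_fraction e m n j k = degree_count m k ps / n"
proof -
  define L where "L = m * (n - 1) + (j - 1)"
  have m: "0 < m" using j by auto
  have idx: "idx m v i = Suc (m * (v - 1) + (i - 1))" if "1 \<le> i" for v i
    using that by (simp add: idx_def)
  have idx_nj: "idx m n j = Suc L" using j by (simp add: idx L_def)
  have len: "length ps = L" and pl: "parent_list ps" using ps by (auto simp: histories_def L_def)
  have L: "L div m = n - 1" unfolding L_def by (rule idx_div[OF j])
  have verts: "verts (pa e m n j) = {1..n}"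
  proof -
    have "m * (v - 1) \<le> L \<longleftrightarrow> v \<le> n" if "1 \<le> v" for v
    proof -
      have "m * (v - 1) \<le> L \<longleftrightarrow> v - 1 \<le> L div m" using m by (simp add: less_eq_div_iff_mult_less_eq mult.commute)
      then show ?thesis using that n L by auto
    qed
    then show ?thesis
      by (auto simp: pa_def cbp_def idx_nj idx tau_le_iff)
  qed
  have deg: "pa_degree e m n j v = vertex_degree m ps (v - 1)" if "1 \<le> v" for v
  proof -
    have count: "birth_count (e (individual e (Suc i))) (tau e (Suc L) - tau e (Suc i)) = count_list ps i" for i
    proof (cases "i \<le> L")
      case True
      then show ?thesis
        using history_birth_count[of ps \<omega> S E i] history_individual[of ps \<omega> S E i]
          tau_history[OF ps, folded L_def, of i] tau_history[OF ps, folded L_def, of L] pl ps len pos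
        by simp
    next
      case False
      \<comment> \<open>An individual not yet born is evaluated at a negative age, where
        \<open>birth_count\<close> is 0 by convention.\<close>
      then have "tau e (Suc L) < tau e (Suc i)" by (intro tau_strict_mono) simp
      then show ?thesis
        using count_list_new[OF pl, of i] False len by (simp add: birth_count_def)
    qed
    have "pa_degree e m n j v = (\<Sum>i=1..m. count_list ps (m * (v - 1) + (i - 1)))"
      unfolding pa_degree_def cbp_degree_def idx_nj
    proof (intro sum.cong refl)
      fix i assume "i \<in> {1..m}"
      then have "1 \<le> i" by simp
      then show "birth_count (e (individual e (idx m v i))) (tau e (Suc L) - tau e (idx m v i)) =
          count_list ps (m * (v - 1) + (i - 1))"
        by (simp only: idx count)
    qed
    also have "\<dots> = vertex_degree m ps (v - 1)"
      unfolding vertex_degree_def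
      by (rule sum.reindex_bij_witness[of _ Suc "\<lambda>i. i - 1"]) auto
    finally show ?thesis .
  qed
  have "real (card {v \<in> verts (pa e m n j). pa_degree e m n j v = k}) =
      (\<Sum>v=1..n. of_bool (vertex_degree m ps (v - 1) = k))"
  proof -
    have "{v \<in> verts (pa e m n j). pa_degree e m n j v = k} = {1..n} \<inter> {v. vertex_degree m ps (v - 1) = k}"
      using deg by (auto simp: verts)
    then show ?thesis by (simp add: sum_of_bool_eq)
  qed
  also have "\<dots> = degree_count m k ps"
    unfolding degree_count_def len L
    using n by (intro sum.reindex_bij_witness[of _ Suc "\<lambda>i. i - 1"]) auto
  finally show ?thesis by (simp add: degree_fraction_def verts)
qed

end

text \<open>Raising \<open>k\<close> by one multiplies the Gamma quotient by
  \<open>(k + a) / (k + a + 2 + c)\<close>, where \<open>2 + c\<close> is \<open>1 + c\<close> plus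
  the step of \<open>k\<close>. The prefactor is adjusted to the value of
  \<open>q 0\<close>.\<close>

lemma limit_law_recursion:
  fixes a c :: real
  assumes "0 < a" "0 < c"
  defines "q \<equiv> \<lambda>k::nat. (1 + c) * (Gamma (1 + c + a) / Gamma a) * (Gamma (k + a) / Gamma (k + a + 2 + c))"
  shows "q 0 * (1 + c + a) = 1 + c" and "q (Suc k) * (1 + c + Suc k + a) = (k + a) * q k"
proof -
  have G: "Gamma (x + 1) = x * Gamma x" if "0 < x" for x :: real
    using that by (auto intro!: Gamma_plus1 dest: nonpos_Ints_nonpos)
  have nonzero: "Gamma x \<noteq> 0" if "0 < x" for x :: real
    using Gamma_real_pos[OF that] by (metis less_irrefl)
  have "Gamma (a + 2 + c) = (1 + c + a) * Gamma (1 + c + a)"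
    using G[of "1 + c + a"] assms(1,2) by (simp add: algebra_simps)
  then show "q 0 * (1 + c + a) = 1 + c"
    using nonzero[of a] nonzero[of "1 + c + a"] assms(1,2) unfolding q_def by simp
  define x where "x = k + a"
  have x: "0 < x" using assms by (simp add: x_def)
  have "Gamma (Suc k + a) = x * Gamma x" "Gamma (Suc k + a + 2 + c) = (x + 2 + c) * Gamma (x + 2 + c)"
    using G[of x] G[of "x + 2 + c"] x assms(1,2) by (auto simp: x_def algebra_simps)
  then have "q (Suc k) = (1 + c) * (Gamma (1 + c + a) / Gamma a) * (x * Gamma x / ((x + 2 + c) * Gamma (x + 2 + c)))"
    by (simp add: q_def)
  moreover have "x + 2 + c \<noteq> 0" using x assms(2) by simp
  ultimately have "q (Suc k) * (x + 2 + c) = x * ((1 + c) * (Gamma (1 + c + a) / Gamma a) * (Gamma x / Gamma (x + 2 + c)))"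
    by simp
  moreover have "1 + c + Suc k + a = x + 2 + c" by (simp add: x_def)
  ultimately show "q (Suc k) * (1 + c + Suc k + a) = (k + a) * q k"
    by (simp only: q_def x_def)
qed

theorem theorem1p5:
  fixes M :: "'w measure" and E :: "nat list \<Rightarrow> nat \<Rightarrow> 'w \<Rightarrow> real"
    and m j k :: nat and \<delta> :: real
  assumes "m \<ge> 2" and "\<delta> > - real m"
    and "birth_clocks M (\<lambda>i. real i + 1 + \<delta> / real m) E"
    and "j \<in> {1..m}"
  shows "converges_in_probability M
           (\<lambda>n \<omega>. degree_fraction (\<lambda>x i. E x i \<omega>) m n j k)
           (\<lambda>\<omega>. (2 + \<delta> / real m) * (Gamma (2 + \<delta> / real m + real m + \<delta>) / Gamma (real m + \<delta>)) *
              (Gamma (real k + real m + \<delta>) / Gamma (real k + real m + \<delta> + 3 + \<delta> / real m)))"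
proof -
  \<comment> \<open>The rates are \<open>k + c\<close>, and \<open>m\<close> childless individuals
    have the joint rate \<open>m * c = m + \<delta>\<close>, named \<open>a\<close>.\<close>
  define c where "c = 1 + \<delta> / m"
  define a where "a = m + \<delta>"
  define q where "q k = (1 + c) * (Gamma (1 + c + a) / Gamma a) * (Gamma (k + a) / Gamma (k + a + 2 + c))" for k :: nat
  have m: "0 < m" using assms(1) by simp
  have a: "0 < a" using assms(2) by (simp add: a_def)
  have c: "0 < c" using assms(2) m by (simp add: c_def field_simps)
  have mc: "m * c = a" using m by (simp add: c_def a_def field_simps)
  have clocks: "birth_clocks M (\<lambda>i. i + c) E"
    using assms(3) by (simp add: c_def add.assoc)
  have rate: "0 < real i + c" for i using c by simp
  interpret prob_space M using clocks by (simp add: birth_clocks_def)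
  interpret degree_recursion m c q
    using m c limit_law_recursion[OF a c] by unfold_locales (auto simp: mc q_def)
  have q_eq: "(2 + \<delta> / real m) * (Gamma (2 + \<delta> / real m + real m + \<delta>) / Gamma (real m + \<delta>)) *
      (Gamma (real k + real m + \<delta>) / Gamma (real k + real m + \<delta> + 3 + \<delta> / real m)) = q k"
    by (simp add: q_def c_def a_def add.assoc add.commute add.left_commute)
  have hist: "history_event (space M) E ps \<in> sets M"
    "prob (history_event (space M) E ps) = history_prob (\<lambda>i. i + c) ps" if "ps \<in> histories L" for ps L
    using history_clocks[OF clocks rate, of ps] that by (auto simp: histories_def)
  have nonneg: "0 \<le> history_prob (\<lambda>i. i + c) ps" for ps
    by (intro history_prob_nonneg rate)
  have AE_hist: "AE \<omega> in M. (\<forall>x k. 0 < E x k \<omega>) \<and> (\<forall>L. \<exists>ps\<in>histories L. \<omega> \<in> history_event (space M) E ps)"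
    using AE_birth_clocks_pos[OF clocks rate] AE_history[OF clocks rate]
    by (simp add: AE_all_countable AE_conj_iff)
  obtain C where C: "\<And>L. mean L (\<lambda>ps. (degree_count m k ps - q k * (real (L div m) + 1))\<^sup>2) \<le> C * (real L + 1)"
    using degree_count_second_moment by blast
  \<comment> \<open>Chebyshev's inequality on histories. The absolute value of \<open>C\<close>
    appears because its sign is not specified, and the factor \<open>m * n\<close> bounds the number
    \<open>L + 1\<close> of individuals.\<close>
  have bound: "prob {\<omega>\<in>space M. \<epsilon> < \<bar>degree_fraction (\<lambda>x i. E x i \<omega>) m n j k - q k\<bar>} \<le> \<bar>C\<bar> * m / \<epsilon>\<^sup>2 / n"
    if \<epsilon>: "0 < \<epsilon>" and n: "1 \<le> n" for \<epsilon> n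
  proof -
    define L where "L = m * (n - 1) + (j - 1)"
    define bad where "bad = {ps\<in>histories L. \<epsilon> < \<bar>degree_count m k ps / n - q k\<bar>}"
    have bad: "finite bad" "bad \<subseteq> histories L" by (auto simp: bad_def)
    have L: "real (L div m) + 1 = n" "real L + 1 \<le> m * n"
    proof -
      have "L div m = n - 1" unfolding L_def by (rule idx_div[OF assms(4)])
      then show "real (L div m) + 1 = n" using n by simp
      have "L + 1 \<le> m * (n - 1) + m" using assms(4) by (simp add: L_def)
      also have "\<dots> = m * n" using n by (cases n) auto
      finally show "real L + 1 \<le> m * n" by (metis of_nat_1 of_nat_add of_nat_le_iff of_nat_mult)
    qed
    have "prob {\<omega>\<in>space M. \<epsilon> < \<bar>degree_fraction (\<lambda>x i. E x i \<omega>) m n j k - q k\<bar>} \<le>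
        prob (\<Union>ps\<in>bad. history_event (space M) E ps)"
    proof (rule finite_measure_mono_AE)
      show "AE \<omega> in M. \<omega> \<in> {\<omega>\<in>space M. \<epsilon> < \<bar>degree_fraction (\<lambda>x i. E x i \<omega>) m n j k - q k\<bar>} \<longrightarrow>
          \<omega> \<in> (\<Union>ps\<in>bad. history_event (space M) E ps)"
        using AE_hist
      proof eventually_elim
        case (elim \<omega>)
        then interpret realised_histories "space M" E \<omega> by unfold_locales auto
        obtain ps where ps: "ps \<in> histories L" "\<omega> \<in> history_event (space M) E ps" using elim by blast
        show ?case
          using ps degree_fraction_history[OF ps[unfolded L_def] n assms(4)] by (auto simp: bad_def)
      qed
    qed (use bad hist in \<open>auto intro!: sets.finite_UN\<close>)
    also have "\<dots> \<le> (\<Sum>ps\<in>bad. prob (history_event (space M) E ps))"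
      using bad hist by (intro finite_measure_subadditive_finite) auto
    also have "\<dots> = (\<Sum>ps\<in>bad. history_prob (\<lambda>i. i + c) ps)"
      using bad hist by (intro sum.cong) auto
    \<comment> \<open>On \<open>bad\<close> histories the inserted quotient is at least 1.\<close>
    also have "\<dots> \<le> (\<Sum>ps\<in>bad. history_prob (\<lambda>i. i + c) ps * ((degree_count m k ps - q k * n)\<^sup>2 / (\<epsilon> * n)\<^sup>2))"
    proof (rule sum_mono)
      fix ps assume "ps \<in> bad"
      then have "\<epsilon> < \<bar>degree_count m k ps / n - q k\<bar>" by (simp add: bad_def)
      also have "degree_count m k ps / n - q k = (degree_count m k ps - q k * n) / n"
        using n by (simp add: diff_divide_distrib)
      finally have "\<epsilon> * n \<le> \<bar>degree_count m k ps - q k * n\<bar>"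
        using n by (simp add: pos_less_divide_eq less_imp_le)
      then have "(\<epsilon> * n)\<^sup>2 \<le> (degree_count m k ps - q k * n)\<^sup>2"
        using \<epsilon> by (simp add: abs_le_square_iff[symmetric])
      then have "1 \<le> (degree_count m k ps - q k * n)\<^sup>2 / (\<epsilon> * n)\<^sup>2"
        using \<epsilon> n by (simp add: divide_simps)
      then show "history_prob (\<lambda>i. i + c) ps \<le>
          history_prob (\<lambda>i. i + c) ps * ((degree_count m k ps - q k * n)\<^sup>2 / (\<epsilon> * n)\<^sup>2)"
        using mult_left_mono[OF _ nonneg[of ps]] by force
    qed
    also have "\<dots> \<le> (\<Sum>ps\<in>histories L. history_prob (\<lambda>i. i + c) ps * ((degree_count m k ps - q k * n)\<^sup>2 / (\<epsilon> * n)\<^sup>2))"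
      using bad nonneg
      by (intro sum_mono2) (auto intro!: mult_nonneg_nonneg divide_nonneg_nonneg)
    also have "\<dots> = mean L (\<lambda>ps. (degree_count m k ps - q k * n)\<^sup>2) / (\<epsilon> * n)\<^sup>2"
      by (simp add: mean_def sum_divide_distrib)
    also have "\<dots> \<le> (\<bar>C\<bar> * (m * n)) / (\<epsilon> * n)\<^sup>2"
    proof (rule divide_right_mono)
      have "C * (real L + 1) \<le> \<bar>C\<bar> * (m * n)"
        using L(2) by (intro mult_mono) auto
      then show "mean L (\<lambda>ps. (degree_count m k ps - q k * n)\<^sup>2) \<le> \<bar>C\<bar> * (m * n)"
        using C[of L] unfolding L(1) by linarith
    qed simp
    also have "\<dots> = \<bar>C\<bar> * m / \<epsilon>\<^sup>2 / n"
      using n by (simp add: power2_eq_square)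
    finally show ?thesis .
  qed
  show ?thesis
    unfolding converges_in_probability_def q_eq
  proof (intro conjI allI impI)
    fix \<epsilon> :: real assume \<epsilon>: "0 < \<epsilon>"
    show "(\<lambda>n. prob {\<omega>\<in>space M. \<epsilon> < \<bar>degree_fraction (\<lambda>x i. E x i \<omega>) m n j k - q k\<bar>}) \<longlonglongrightarrow> 0"
    proof (rule tendsto_sandwich[of "\<lambda>_. 0"])
      show "\<forall>\<^sub>F n in sequentially. prob {\<omega>\<in>space M. \<epsilon> < \<bar>degree_fraction (\<lambda>x i. E x i \<omega>) m n j k - q k\<bar>}
          \<le> \<bar>C\<bar> * m / \<epsilon>\<^sup>2 / n"
        using eventually_ge_at_top[of 1] by eventually_elim (rule bound[OF \<epsilon>])
      show "(\<lambda>n. \<bar>C\<bar> * m / \<epsilon>\<^sup>2 / real n) \<longlonglongrightarrow> 0"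
        by (rule lim_const_over_n)
    qed auto
  qed (auto intro: degree_fraction_measurable[OF clocks])
qed

end
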